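(* Let $W=W(E_7)$ be the Coxeter group of type $E_7$ with longest element $w_o$ (which is central and acts as $-1$ in the reflection representation). The involutions in $W$ form exactly ten conjugacy classes, namely the pairwise distinct classes $[w_\emptyset]$, $[w_{\{1,2,3,4,5,6,7\}}]$, $[w_{\{1\}}]=[w_{\{3\}}]$, $[w_{\{2,3,4,5,6,7\}}]$, $[w_{\{1,4\}}]=[w_{\{1,5\}}]$, $[w_{\{2,3,4,5,7\}}]$, $[w_{\{1,4,6\}}]=[w_{\{1,2,7\}}]$, $[w_{\{1,2,5,7\}}]=[w_{\{2,3,5,7\}}]$, $[w_{\{2,5,7\}}]$, $[w_{\{2,3,4,5\}}]$. Multiplication by $w_o=-1$ acts on these classes as follows: (1) it interchanges $[w_\emptyset]$ and $[w_{\{1,2,3,4,5,6,7\}}]$; (2) it interchanges $[w_{\{1\}}]$ and $[w_{\{2,3,4,5,6,7\}}]$; (3) it interchanges $[w_{\{1,4\}}]$ and $[w_{\{2,3,4,5,7\}}]$; (4) it interchanges $[w_{\{1,4,6\}}]$ and $[w_{\{1,2,5,7\}}]$; (5) it interchanges $[w_{\{2,5,7\}}]$ and $[w_{\{2,3,4,5\}}]$.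
   Context: The nodes of the Coxeter graph $E_7$ are numbered as in Bourbaki: nodes $1,3,4,5,6,7$ form a path in this order and node $2$ is joined to node $4$; all edges have label $3$. Node $i$ corresponds to the simple generator $s_i$. For a set of nodes $I$, $W_I$ denotes the parabolic subgroup generated by $\{s_i: i\in I\}$, and $w_I$ denotes its longest element ($w_\emptyset=1$). An involution is an element $x$ with $x^2=1$ (the identity is included); $[x]$ denotes the conjugacy class of $x$ in $W$. *)

theory Defs
  imports Complex_Main "HOL-Algebra.Generated_Groups"
begin

section \<open>Coxeter groups\<close>

text \<open>
  A Coxeter matrix \<open>m\<close> over the index set \<open>I\<close> is given as a function, with \<open>m i j = 0\<close> standing for
  the label infinity. The Coxeter group is presented by generators \<open>i \<in> I\<close> and relators
  \<open>(i j)\<^sup>m\<close>, \<open>m = m i j\<close>. Since \<open>m i i = 1\<close>, the relators \<open>i i\<close> make every generator its own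
  inverse, so words in the generators alone suffice and the presented monoid is the presented group.
\<close>

inductive cox_eq :: "'i set \<Rightarrow> ('i \<Rightarrow> 'i \<Rightarrow> nat) \<Rightarrow> 'i list \<Rightarrow> 'i list \<Rightarrow> bool"
  for I :: "'i set" and m :: "'i \<Rightarrow> 'i \<Rightarrow> nat" where
  cox_refl: "u \<in> lists I \<Longrightarrow> cox_eq I m u u"
| cox_sym: "cox_eq I m u v \<Longrightarrow> cox_eq I m v u"
| cox_trans: "cox_eq I m u v \<Longrightarrow> cox_eq I m v w \<Longrightarrow> cox_eq I m u w"
| cox_rel: "\<lbrakk>i \<in> I; j \<in> I; u \<in> lists I; v \<in> lists I\<rbrakk>
    \<Longrightarrow> cox_eq I m (u @ concat (replicate (m i j) [i, j]) @ v) (u @ v)"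

definition cox_class :: "'i set \<Rightarrow> ('i \<Rightarrow> 'i \<Rightarrow> nat) \<Rightarrow> 'i list \<Rightarrow> 'i list set" where
  "cox_class I m u = {v. cox_eq I m u v}"

definition coxeter_group :: "'i set \<Rightarrow> ('i \<Rightarrow> 'i \<Rightarrow> nat) \<Rightarrow> 'i list set monoid" where
  "coxeter_group I m =
     \<lparr>carrier = cox_class I m ` lists I,
      monoid.mult = (\<lambda>A B. \<Union>a\<in>A. \<Union>b\<in>B. cox_class I m (a @ b)),
      one = cox_class I m []\<rparr>"

lemma cox_eq_lists: "cox_eq I m u v \<Longrightarrow> u \<in> lists I \<and> v \<in> lists I"
proof (induction rule: cox_eq.induct)
  case (cox_rel i j u v)
  then have "concat (replicate k [i, j]) \<in> lists I" for k by (induction k) auto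
  then show ?case using cox_rel by simp
qed auto

lemma cox_eq_context:
  assumes "cox_eq I m u v" "a \<in> lists I" "b \<in> lists I"
  shows "cox_eq I m (a @ u @ b) (a @ v @ b)"
  using assms
proof (induction rule: cox_eq.induct)
  case (cox_refl u)
  then show ?case by (intro cox_eq.cox_refl) auto
next
  case (cox_rel i j u v)
  then show ?case using cox_eq.cox_rel[of i I j "a @ u" "v @ b" m] by simp
qed (blast intro: cox_eq.cox_sym cox_eq.cox_trans)+

lemma cox_eq_append:
  assumes "cox_eq I m u u'" "cox_eq I m v v'"
  shows "cox_eq I m (u @ v) (u' @ v')"
proof -
  have "cox_eq I m (u @ v) (u' @ v)"
    using cox_eq_context[OF assms(1), of "[]" v] cox_eq_lists[OF assms(2)] by simp
  moreover have "cox_eq I m (u' @ v) (u' @ v')"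
    using cox_eq_context[OF assms(2), of u' "[]"] cox_eq_lists[OF assms(1)] by simp
  ultimately show ?thesis by (rule cox_eq.cox_trans)
qed

lemma cox_class_eq_iff:
  assumes "u \<in> lists I"
  shows "cox_class I m u = cox_class I m v \<longleftrightarrow> cox_eq I m u v"
  using assms unfolding cox_class_def
  by (blast intro: cox_eq.cox_refl cox_eq.cox_sym cox_eq.cox_trans)

lemma coxeter_group_mult:
  assumes "u \<in> lists I" "v \<in> lists I"
  shows "cox_class I m u \<otimes>\<^bsub>coxeter_group I m\<^esub> cox_class I m v = cox_class I m (u @ v)"
proof -
  have "cox_class I m (a @ b) = cox_class I m (u @ v)"
    if "a \<in> cox_class I m u" "b \<in> cox_class I m v" for a b
  proof -
    have "cox_eq I m (u @ v) (a @ b)"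
      using that by (auto simp: cox_class_def intro: cox_eq_append)
    moreover have "u @ v \<in> lists I" using assms by simp
    ultimately show ?thesis using cox_class_eq_iff by metis
  qed
  moreover have "u \<in> cox_class I m u" "v \<in> cox_class I m v"
    using assms by (auto simp: cox_class_def intro: cox_eq.cox_refl)
  ultimately have "(\<Union>a\<in>cox_class I m u. \<Union>b\<in>cox_class I m v. cox_class I m (a @ b))
      = cox_class I m (u @ v)"
    by blast
  then show ?thesis by (simp add: coxeter_group_def)
qed

lemma cox_eq_rev:
  assumes "\<And>i. i \<in> I \<Longrightarrow> m i i = 1" "u \<in> lists I"
  shows "cox_eq I m (rev u @ u) []"
  using assms(2)
proof (induction u)
  case Nil
  then show ?case by (simp add: cox_eq.cox_refl)
next
  case (Cons i u)
  then have "cox_eq I m (rev u @ [i, i] @ u) (rev u @ u)"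
    using cox_eq.cox_rel[of i I i "rev u" u m] assms(1)[of i] by (simp add: in_lists_conv_set)
  then have "cox_eq I m (rev u @ [i, i] @ u) []"
    using Cons by (blast intro: cox_eq.cox_trans)
  then show ?case by simp
qed

lemma group_coxeter_group:
  assumes "\<And>i. i \<in> I \<Longrightarrow> m i i = 1"
  shows "group (coxeter_group I m)"
proof -
  have car: "carrier (coxeter_group I m) = cox_class I m ` lists I"
    and one: "\<one>\<^bsub>coxeter_group I m\<^esub> = cox_class I m []"
    by (simp_all add: coxeter_group_def)
  show ?thesis
  proof (rule groupI)
    fix x assume "x \<in> carrier (coxeter_group I m)"
    then obtain u where u: "u \<in> lists I" "x = cox_class I m u" by (auto simp: car)
    then have ru: "rev u \<in> lists I" by (simp add: in_lists_conv_set)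
    have "cox_class I m (rev u) \<otimes>\<^bsub>coxeter_group I m\<^esub> x = \<one>\<^bsub>coxeter_group I m\<^esub>"
      unfolding one u(2) coxeter_group_mult[OF ru u(1)]
      using cox_eq_rev[of I m u] assms u(1) ru by (subst cox_class_eq_iff) auto
    then show "\<exists>y\<in>carrier (coxeter_group I m). y \<otimes>\<^bsub>coxeter_group I m\<^esub> x = \<one>\<^bsub>coxeter_group I m\<^esub>"
      using ru unfolding car by blast
  qed (unfold car one, ((elim imageE)?,
      simp add: coxeter_group_mult append_in_lists_conv imageI del: in_lists_conv_set)+)
qed

definition cox_gen :: "'i set \<Rightarrow> ('i \<Rightarrow> 'i \<Rightarrow> nat) \<Rightarrow> 'i \<Rightarrow> 'i list set" where
  "cox_gen I m i = cox_class I m [i]"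

text \<open>A group element is the set of all words representing it.\<close>

definition cox_length :: "'i list set \<Rightarrow> nat" where
  "cox_length x = (LEAST n. \<exists>u\<in>x. length u = n)"

definition parabolic :: "'i set \<Rightarrow> ('i \<Rightarrow> 'i \<Rightarrow> nat) \<Rightarrow> 'i set \<Rightarrow> 'i list set set" where
  "parabolic I m J = generate (coxeter_group I m) (cox_gen I m ` J)"

definition longest_element :: "'i list set set \<Rightarrow> 'i list set" where
  "longest_element H = (THE x. x \<in> H \<and> (\<forall>y\<in>H. cox_length y \<le> cox_length x))"

text \<open>
  The reflection representation on the real vector space with basis \<open>\<alpha>\<^sub>i\<close> (\<open>i \<in> I\<close>) and the form
  \<open>B(\<alpha>\<^sub>i, \<alpha>\<^sub>j) = - cos (\<pi> / m i j)\<close> (which is \<open>-1\<close> for the label infinity, as \<open>\<pi> / 0 = 0\<close> and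
  \<open>cos 0 = 1\<close>). A vector is given by its coordinates with respect to this basis, of which only
  those indexed by \<open>I\<close> matter; \<open>i\<close> acts by \<open>v \<mapsto> v - 2 B(\<alpha>\<^sub>i, v) \<alpha>\<^sub>i\<close>.
\<close>

definition simple_reflection ::
    "'i set \<Rightarrow> ('i \<Rightarrow> 'i \<Rightarrow> nat) \<Rightarrow> 'i \<Rightarrow> ('i \<Rightarrow> real) \<Rightarrow> 'i \<Rightarrow> real" where
  "simple_reflection I m i v =
     v(i := v i - 2 * (\<Sum>j\<in>I. - cos (pi / real (m i j)) * v j))"

text \<open>The choice of the representing word is immaterial, as the simple reflections satisfy the
  Coxeter relations.\<close>

definition reflection_rep ::
    "'i set \<Rightarrow> ('i \<Rightarrow> 'i \<Rightarrow> nat) \<Rightarrow> 'i list set \<Rightarrow> ('i \<Rightarrow> real) \<Rightarrow> 'i \<Rightarrow> real" where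
  "reflection_rep I m x = foldr (simple_reflection I m) (SOME u. u \<in> x)"

section \<open>Conjugacy classes and involutions in a group\<close>

definition conj_class :: "('a, 'b) monoid_scheme \<Rightarrow> 'a \<Rightarrow> 'a set" where
  "conj_class G x = {g \<otimes>\<^bsub>G\<^esub> x \<otimes>\<^bsub>G\<^esub> inv\<^bsub>G\<^esub> g | g. g \<in> carrier G}"

text \<open>The identity counts as an involution.\<close>

definition involutions :: "('a, 'b) monoid_scheme \<Rightarrow> 'a set" where
  "involutions G = {x \<in> carrier G. x \<otimes>\<^bsub>G\<^esub> x = \<one>\<^bsub>G\<^esub>}"

definition interchanges_classes :: "('a, 'b) monoid_scheme \<Rightarrow> 'a \<Rightarrow> 'a set \<Rightarrow> 'a set \<Rightarrow> bool" where
  "interchanges_classes G z A B \<longleftrightarrow> z <#\<^bsub>G\<^esub> A = B \<and> z <#\<^bsub>G\<^esub> B = A"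

section \<open>The Coxeter group of type E7\<close>

definition E7_nodes :: "nat set" where
  "E7_nodes = {1..7}"

definition E7_edges :: "nat set set" where
  "E7_edges = {{1,3}, {3,4}, {4,5}, {5,6}, {6,7}, {2,4}}"

definition E7_matrix :: "nat \<Rightarrow> nat \<Rightarrow> nat" where
  "E7_matrix i j = (if i = j then 1 else if {i, j} \<in> E7_edges then 3 else 2)"

definition W_E7 :: "nat list set monoid" where
  "W_E7 = coxeter_group E7_nodes E7_matrix"

lemma group_W_E7: "group W_E7"
  unfolding W_E7_def by (rule group_coxeter_group) (simp add: E7_matrix_def)

definition w_E7 :: "nat set \<Rightarrow> nat list set" where
  "w_E7 J = longest_element (parabolic E7_nodes E7_matrix J)"

definition wo_E7 :: "nat list set" where
  "wo_E7 = longest_element (carrier W_E7)"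

definition cl_E7 :: "nat set \<Rightarrow> nat list set set" where
  "cl_E7 J = conj_class W_E7 (w_E7 J)"

end

theory Submission
  imports Defs
begin

text \<open>
  Each conjugacy class of involutions contains an element \<open>x\<close> of minimal length, and such an \<open>x\<close>
  negates every simple root at which it has a descent; if these roots form the set \<open>J\<close>, then
  \<open>x = w\<^sub>J\<close> (Richardson). So only the 128 subsets \<open>J\<close> have to be inspected, and for 40 of them
  \<open>w\<^sub>J\<close> acts as \<open>-1\<close> on the span of \<open>J\<close>. An element of the group is determined by the image of one
  strictly dominant functional on the root lattice, which turns identities between words into a
  computation with seven integers. The classes are separated by the trace on the root
  lattice together with the parity of the form \<open>(x v, v)\<close>, which distinguishes the two classes of
  products of three commuting reflections; \<open>-1\<close> negates the former and preserves the latter.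
\<close>

section \<open>Conjugacy classes\<close>

text \<open>The group is a quotient of a set of words, so neither equality nor length is directly
  computable. Both are read off from signs: the image of a simple root has all coordinates
  nonnegative or all nonpositive, and the sign of \<open>act u (unit_vec s)\<close> tells whether
  \<open>s\<close> lengthens or shortens \<open>u\<close> from the right. Hence an element without
  descents is trivial. This yields the faithfulness of the action, the uniqueness demanded by the
  definite description \<open>longest_element\<close>, and the test by a functional: an element
  fixing some \<omega> that is positive on the simple roots sends each of them to a root of positive
  value, so it has no descent. Invariants are evaluated only on five products of at most three
  commuting reflections; the other five classes are multiples of these by
  \<open>wo_E7\<close>.\<close>

lemma conj_class_mono:
  assumes "group G" "x \<in> carrier G" "g \<in> carrier G"
  shows "conj_class G (g \<otimes>\<^bsub>G\<^esub> x \<otimes>\<^bsub>G\<^esub> inv\<^bsub>G\<^esub> g) \<subseteq> conj_class G x"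
proof -
  interpret group G by fact
  have "h \<otimes>\<^bsub>G\<^esub> (g \<otimes>\<^bsub>G\<^esub> x \<otimes>\<^bsub>G\<^esub> inv\<^bsub>G\<^esub> g) \<otimes>\<^bsub>G\<^esub> inv\<^bsub>G\<^esub> h
      = (h \<otimes>\<^bsub>G\<^esub> g) \<otimes>\<^bsub>G\<^esub> x \<otimes>\<^bsub>G\<^esub> inv\<^bsub>G\<^esub> (h \<otimes>\<^bsub>G\<^esub> g)" if "h \<in> carrier G" for h
    using that assms by (simp add: m_assoc inv_mult_group)
  then show ?thesis unfolding conj_class_def using assms by blast
qed

lemma conj_class_eqI:
  assumes "group G" "x \<in> carrier G" "y \<in> carrier G" "g \<in> carrier G"
    and "g \<otimes>\<^bsub>G\<^esub> x = y \<otimes>\<^bsub>G\<^esub> g"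
  shows "conj_class G x = conj_class G y"
proof
  interpret group G by fact
  have "g \<otimes>\<^bsub>G\<^esub> x \<otimes>\<^bsub>G\<^esub> inv\<^bsub>G\<^esub> g = y"
    using assms by (simp add: m_assoc)
  then show "conj_class G y \<subseteq> conj_class G x" using conj_class_mono[of G x g] assms by simp
  have "inv\<^bsub>G\<^esub> g \<otimes>\<^bsub>G\<^esub> y \<otimes>\<^bsub>G\<^esub> inv\<^bsub>G\<^esub> (inv\<^bsub>G\<^esub> g) = x"
    using assms(2-4) assms(5)[symmetric] by (simp add: m_assoc) (simp add: m_assoc[symmetric])
  then show "conj_class G x \<subseteq> conj_class G y"
    using conj_class_mono[of G y "inv\<^bsub>G\<^esub> g"] assms by simp
qed

text \<open>For central \<open>z\<close> the coset of the class of \<open>x\<close> is the class of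
  \<open>z x\<close>, and \<open>z z = 1\<close> leads back. So a single conjugacy, from
  \<open>z x\<close> into \<open>C\<close>, settles both directions.\<close>

lemma interchanges_conj_classes:
  assumes "group G" and z: "z \<in> carrier G" "z \<otimes>\<^bsub>G\<^esub> z = \<one>\<^bsub>G\<^esub>"
    and central: "\<And>x. x \<in> carrier G \<Longrightarrow> z \<otimes>\<^bsub>G\<^esub> x = x \<otimes>\<^bsub>G\<^esub> z"
    and x: "x \<in> carrier G" and conj: "conj_class G (z \<otimes>\<^bsub>G\<^esub> x) = C"
  shows "interchanges_classes G z (conj_class G x) C"
proof -
  interpret group G by fact
  have coset: "z <#\<^bsub>G\<^esub> conj_class G x = conj_class G (z \<otimes>\<^bsub>G\<^esub> x)" if x: "x \<in> carrier G" for x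
  proof -
    have "z \<otimes>\<^bsub>G\<^esub> (g \<otimes>\<^bsub>G\<^esub> x \<otimes>\<^bsub>G\<^esub> inv\<^bsub>G\<^esub> g) = g \<otimes>\<^bsub>G\<^esub> (z \<otimes>\<^bsub>G\<^esub> x) \<otimes>\<^bsub>G\<^esub> inv\<^bsub>G\<^esub> g"
      if "g \<in> carrier G" for g
    proof -
      have "z \<otimes>\<^bsub>G\<^esub> (g \<otimes>\<^bsub>G\<^esub> x \<otimes>\<^bsub>G\<^esub> inv\<^bsub>G\<^esub> g) = (z \<otimes>\<^bsub>G\<^esub> g) \<otimes>\<^bsub>G\<^esub> (x \<otimes>\<^bsub>G\<^esub> inv\<^bsub>G\<^esub> g)"
        using that x z by (simp add: m_assoc)
      also have "\<dots> = g \<otimes>\<^bsub>G\<^esub> (z \<otimes>\<^bsub>G\<^esub> x) \<otimes>\<^bsub>G\<^esub> inv\<^bsub>G\<^esub> g"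
        using that x z by (simp add: central[of g] m_assoc)
      finally show ?thesis .
    qed
    moreover have "conj_class G y = (\<lambda>g. g \<otimes>\<^bsub>G\<^esub> y \<otimes>\<^bsub>G\<^esub> inv\<^bsub>G\<^esub> g) ` carrier G" for y
      by (auto simp: conj_class_def)
    ultimately show ?thesis
      by (simp add: l_coset_def UNION_singleton_eq_range image_image cong: image_cong)
  qed
  have "z <#\<^bsub>G\<^esub> conj_class G (z \<otimes>\<^bsub>G\<^esub> x) = conj_class G x"
    using coset[of "z \<otimes>\<^bsub>G\<^esub> x"] z x by (simp add: m_assoc[symmetric])
  then show ?thesis unfolding interchanges_classes_def using coset[OF x] conj by simp
qed

section \<open>Simply laced Coxeter groups\<close>

definition unit_vec :: "'i \<Rightarrow> 'i \<Rightarrow> 'a::comm_ring_1" where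
  "unit_vec s k = (if k = s then 1 else 0)"

definition nonneg :: "('i \<Rightarrow> int) \<Rightarrow> bool" where
  "nonneg v \<longleftrightarrow> (\<forall>k. 0 \<le> v k)"

locale simply_laced =
  fixes I :: "'i set" and m :: "'i \<Rightarrow> 'i \<Rightarrow> nat"
  assumes finite_nodes [simp]: "finite I"
    and diag [simp]: "i \<in> I \<Longrightarrow> m i i = 1"
    and off_diag: "i \<in> I \<Longrightarrow> j \<in> I \<Longrightarrow> i \<noteq> j \<Longrightarrow> m i j = 2 \<or> m i j = 3"
    and sym: "m i j = m j i"
begin

abbreviation eqv (infix "\<sim>" 50) where "u \<sim> v \<equiv> cox_eq I m u v"

abbreviation cls where "cls \<equiv> cox_class I m"

abbreviation W where "W \<equiv> coxeter_group I m"

definition nbr_sum :: "'i \<Rightarrow> ('i \<Rightarrow> 'a::comm_ring_1) \<Rightarrow> 'a" where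
  "nbr_sum i v = (\<Sum>j\<in>I. if m i j = 3 then v j else 0)"

text \<open>For labels 2 and 3 the simple reflection subtracts \<open>2 * v i - nbr_sum i v\<close>
  from coordinate \<open>i\<close>, without denominators. The ring stays arbitrary so that one
  action serves the integral root lattice and the real reflection representation.\<close>

definition refl :: "'i \<Rightarrow> ('i \<Rightarrow> 'a::comm_ring_1) \<Rightarrow> 'i \<Rightarrow> 'a" where
  "refl i v = v(i := nbr_sum i v - v i)"

definition act :: "'i list \<Rightarrow> ('i \<Rightarrow> 'a::comm_ring_1) \<Rightarrow> 'i \<Rightarrow> 'a" where
  "act u = foldr refl u"

lemma act_Nil [simp]: "act [] v = v"
  and act_Cons [simp]: "act (i # u) v = refl i (act u v)"
  and act_append [simp]: "act (u @ u') v = act u (act u' v)"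
  by (simp_all add: act_def)

subsection \<open>The action on vectors\<close>

lemma nbr_sum_upd:
  assumes "j \<in> I"
  shows "nbr_sum i (v(j := c)) = nbr_sum i v + (if m i j = 3 then c - v j else 0)"
proof -
  have "(\<Sum>k\<in>I - {j}. if m i k = 3 then (v(j := c)) k else 0)
      = (\<Sum>k\<in>I - {j}. if m i k = 3 then v k else 0)"
    by (rule sum.cong) simp_all
  then show ?thesis
    unfolding nbr_sum_def using assms by (simp add: sum.remove[of I j])
qed

lemma nbr_sum_add: "nbr_sum i (\<lambda>k. v k + w k) = nbr_sum i v + nbr_sum i w"
  unfolding nbr_sum_def sum.distrib[symmetric] by (rule sum.cong) simp_all

lemma nbr_sum_scale: "nbr_sum i (\<lambda>k. c * v k) = c * nbr_sum i v"
  unfolding nbr_sum_def sum_distrib_left by (rule sum.cong) simp_all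

lemma refl_add: "refl i (\<lambda>k. v k + w k) = (\<lambda>k. refl i v k + refl i w k)"
  by (simp add: refl_def nbr_sum_add fun_eq_iff)

lemma refl_scale: "refl i (\<lambda>k. c * v k) = (\<lambda>k. c * refl i v k)"
  by (simp add: refl_def nbr_sum_scale fun_eq_iff algebra_simps)

lemma act_add: "act u (\<lambda>k. v k + w k) = (\<lambda>k. act u v k + act u w k)"
  by (induction u) (simp_all add: refl_add)

lemma act_scale: "act u (\<lambda>k. c * v k) = (\<lambda>k. c * act u v k)"
  by (induction u) (simp_all add: refl_scale)

lemma act_minus: "act u (\<lambda>k. - v k) = (\<lambda>k. - act u v k)"
  using act_scale[of u "-1" v] by simp

lemma act_zero: "act u (\<lambda>k. 0) = (\<lambda>k. 0)"
  using act_scale[of u 0 "\<lambda>k. 0"] by simp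

lemma act_sum: "act u (\<lambda>k. \<Sum>j\<in>A. f j k) = (\<lambda>k. \<Sum>j\<in>A. act u (f j) k)"
  by (induction A rule: infinite_finite_induct) (simp_all add: act_zero act_add)

lemma refl_refl: "i \<in> I \<Longrightarrow> refl i (refl i v) = v"
  by (simp add: refl_def nbr_sum_upd)

lemma act_relator:
  assumes "i \<in> I" "j \<in> I"
  shows "act (concat (replicate (m i j) [i, j])) v = v"
proof (cases "i = j")
  case True
  then show ?thesis using assms by (simp add: refl_refl)
next
  case False
  have "m j j = 1" "m i i = 1" using assms by simp_all
  moreover have "m i j = 2 \<and> m j i = 2 \<or> m i j = 3 \<and> m j i = 3"
    using off_diag[OF assms False] sym[of i j] by auto
  ultimately show ?thesis using assms False
    by (elim disjE conjE)
      (simp_all add: numeral_eq_Suc, simp_all add: refl_def nbr_sum_upd fun_eq_iff)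
qed

lemma act_cong: "u \<sim> v \<Longrightarrow> act u x = act v x"
  by (induction arbitrary: x rule: cox_eq.induct) (simp_all add: act_relator)

lemma act_inside:
  assumes "u \<in> lists J" "k \<notin> J"
  shows "act u v k = v k"
  using assms by (induction u) (auto simp: refl_def)

lemma unit_decomp:
  assumes "finite J" "\<And>k. k \<notin> J \<Longrightarrow> v k = 0"
  shows "v = (\<lambda>k. \<Sum>j\<in>J. v j * unit_vec j k)"
proof
  fix k show "v k = (\<Sum>j\<in>J. v j * unit_vec j k)"
    using assms by (simp add: unit_vec_def if_distrib[of "\<lambda>x. _ * x"] cong: if_cong)
qed

lemma act_decomp:
  assumes "finite J" "\<And>k. k \<notin> J \<Longrightarrow> v k = 0"
  shows "act u v = (\<lambda>k. \<Sum>j\<in>J. v j * act u (unit_vec j) k)"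
  by (subst unit_decomp[OF assms]) (simp_all add: act_sum act_scale)

subsection \<open>Words and length\<close>

abbreviation len where "len u \<equiv> cox_length (cls u)"

lemma len_eq: "len u = (LEAST n. \<exists>v. u \<sim> v \<and> length v = n)"
  by (simp add: cox_length_def cox_class_def)

lemma eqv_lists: "u \<sim> v \<Longrightarrow> u \<in> lists I" "u \<sim> v \<Longrightarrow> v \<in> lists I"
  using cox_eq_lists[of I m u v] by auto

lemma len_le: "u \<sim> v \<Longrightarrow> len u \<le> length v"
  unfolding len_eq by (rule Least_le) auto

lemma reduced_word:
  assumes "u \<in> lists I"
  obtains v where "u \<sim> v" "length v = len u"
proof -
  have "\<exists>n v. u \<sim> v \<and> length v = n"
    using cox_refl[OF assms, of m] by auto
  then have "\<exists>v. u \<sim> v \<and> length v = len u"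
    unfolding len_eq by (rule LeastI_ex[where P = "\<lambda>n. \<exists>v. u \<sim> v \<and> length v = n"])
  then show thesis using that by blast
qed

lemma len_cong: "u \<sim> v \<Longrightarrow> len u = len v"
  using cox_class_eq_iff[of u I m v] eqv_lists(1) by metis

lemma eqv_lists_append_cong: "u \<sim> u' \<Longrightarrow> v \<in> lists I \<Longrightarrow> u @ v \<sim> u' @ v"
  "u \<sim> u' \<Longrightarrow> v \<in> lists I \<Longrightarrow> v @ u \<sim> v @ u'"
  by (blast intro: cox_eq_append cox_refl)+

lemma rev_lists: "u \<in> lists I \<Longrightarrow> rev u \<in> lists I"
  by (simp add: in_lists_conv_set)

lemma rev_cancel: "u \<in> lists I \<Longrightarrow> rev u @ u \<sim> []"
  by (rule cox_eq_rev) simp_all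

lemma rev_cancel': "u \<in> lists I \<Longrightarrow> u @ rev u \<sim> []"
  using rev_cancel[of "rev u"] rev_lists by simp

lemma eqv_iff_rev_append:
  assumes "u \<in> lists I" "v \<in> lists I"
  shows "u \<sim> v \<longleftrightarrow> rev v @ u \<sim> []"
proof
  assume "u \<sim> v"
  then show "rev v @ u \<sim> []"
    using eqv_lists_append_cong(2)[of u v "rev v"] rev_cancel rev_lists assms cox_trans by blast
next
  assume "rev v @ u \<sim> []"
  then have "v @ rev v @ u \<sim> v"
    using eqv_lists_append_cong(2)[of "rev v @ u" "[]" v] assms by simp
  moreover have "v @ rev v @ u \<sim> u"
    using eqv_lists_append_cong(1)[OF rev_cancel', of v u] assms by simp
  ultimately show "u \<sim> v" using cox_sym cox_trans by blast
qed

lemma eqv_rev: "u \<sim> v \<Longrightarrow> rev u \<sim> rev v"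
proof (induction rule: cox_eq.induct)
  case (cox_rel i j u v)
  have "rev (concat (replicate n [i, j])) = concat (replicate n [j, i])" for n
  proof (induction n)
    case (Suc n)
    have "concat (replicate n [j, i]) @ [j, i] = [j, i] @ concat (replicate n [j, i])" for n
      by (induction n) simp_all
    then show ?case using Suc by simp
  qed simp
  then show ?case
    using cox_eq.cox_rel[of j I i "rev v" "rev u" m] cox_rel rev_lists sym[of i j] by simp
next
  case (cox_refl u)
  then show ?case by (intro cox_eq.cox_refl rev_lists)
next
  case (cox_sym u v)
  show ?case by (rule cox_eq.cox_sym[OF cox_sym.IH])
next
  case (cox_trans u v w)
  show ?case by (rule cox_eq.cox_trans[OF cox_trans.IH])
qed

lemma len_rev:
  assumes "u \<in> lists I"
  shows "len (rev u) = len u"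
proof -
  have "len (rev u) \<le> len u" if "u \<in> lists I" for u
    using reduced_word[OF that] len_le eqv_rev length_rev by metis
  from this[of u] this[of "rev u"] show ?thesis using assms rev_lists by simp
qed

lemma snoc_snoc: "u \<in> lists I \<Longrightarrow> s \<in> I \<Longrightarrow> u @ [s, s] \<sim> u"
  using cox_rel[of s I s u "[]" m] by simp

lemma len_snoc_le:
  assumes "u \<in> lists I" "s \<in> I"
  shows "len (u @ [s]) \<le> Suc (len u)"
proof -
  obtain v where v: "u \<sim> v" "length v = len u" using reduced_word assms(1) by blast
  then have "u @ [s] \<sim> v @ [s]" using eqv_lists_append_cong(1)[of u v "[s]"] assms by simp
  then show ?thesis using len_le[of "u @ [s]" "v @ [s]"] v(2) by simp
qed

lemma len_snoc_snoc: "u \<in> lists I \<Longrightarrow> s \<in> I \<Longrightarrow> len (u @ [s, s]) = len u"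
  by (rule len_cong[OF snoc_snoc])

lemma len_le_snoc:
  assumes "u \<in> lists I" "s \<in> I"
  shows "len u \<le> Suc (len (u @ [s]))"
  using len_snoc_le[of "u @ [s]" s] len_snoc_snoc[of u s] assms by simp

lemma len_Nil [simp]: "len [] = 0"
  using len_le[of "[]" "[]"] cox_refl[of "[]" I m] by simp

lemma len_0: "u \<in> lists I \<Longrightarrow> len u = 0 \<Longrightarrow> u \<sim> []"
  using reduced_word[of u] by (metis length_0_conv)

text \<open>Remove the last letter of a reduced word: \<open>len v\<close> is at most the number of
  remaining letters, and \<open>len_snoc_le\<close> bounds it from below, so the drop is exactly
  one.\<close>

lemma last_descent:
  assumes "u \<in> lists I" "len u \<noteq> 0"
  obtains v t where "v \<in> lists I" "t \<in> I" "u \<sim> v @ [t]" "len u = Suc (len v)"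
proof -
  obtain w where w: "u \<sim> w" "length w = len u" using reduced_word assms(1) by blast
  then have "w \<noteq> []" using assms(2) by auto
  then obtain v t where vt: "w = v @ [t]" by (meson rev_exhaust)
  then have L: "v \<in> lists I" "t \<in> I" using eqv_lists[OF w(1)] by auto
  have "len v \<le> length v" using len_le[OF cox_refl[OF L(1)]] .
  moreover have "len u \<le> Suc (len v)" using len_snoc_le[OF L] len_cong[OF w(1)] vt by simp
  ultimately show thesis using that[OF L] w vt by simp
qed

subsection \<open>Positive roots and length\<close>

lemma refl_unit_self: "s \<in> I \<Longrightarrow> refl s (unit_vec s) = (\<lambda>k. - unit_vec s k :: 'a::comm_ring_1)"
proof -
  assume s: "s \<in> I"
  have "nbr_sum s (unit_vec s :: 'i \<Rightarrow> 'a) = 0"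
    unfolding nbr_sum_def by (rule sum.neutral) (use s in \<open>auto simp: unit_vec_def\<close>)
  then show ?thesis by (simp add: refl_def unit_vec_def fun_eq_iff)
qed

lemma refl_unit:
  assumes "s \<in> I" "t \<in> I" "s \<noteq> t"
  shows "refl t (unit_vec s) = (if m s t = 3 then (\<lambda>k. unit_vec s k + unit_vec t k) else unit_vec s)"
proof -
  have "nbr_sum t (unit_vec s) = (if m s t = 3 then 1 else 0)"
  proof -
    have "nbr_sum t (unit_vec s) = (\<Sum>j\<in>I. if j = s then (if m s t = 3 then 1 else 0) else 0)"
      unfolding nbr_sum_def by (rule sum.cong) (auto simp: unit_vec_def sym)
    then show ?thesis using assms by simp
  qed
  then show ?thesis using assms by (auto simp: refl_def unit_vec_def fun_eq_iff)
qed

text \<open>Humphreys' argument (Theorem 5.4 of his book on reflection groups) in the simply laced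
  case: split off a last letter \<open>t\<close> of \<open>u\<close>, and if necessary a second one equal to \<open>s\<close>.\<close>

lemma nonneg_if_len_le:
  assumes "u \<in> lists I" "s \<in> I" "len u \<le> len (u @ [s])"
  shows "nonneg (act u (unit_vec s))"
  using assms
proof (induction "len u" arbitrary: u s rule: less_induct)
  case less
  show ?case
  proof (cases "len u = 0")
    case True
    then have "act u (unit_vec s) = (unit_vec s :: 'i \<Rightarrow> int)"
      using act_cong[OF len_0] less.prems by fastforce
    then show ?thesis by (simp add: nonneg_def unit_vec_def)
  next
    case False
    then obtain v t where vt: "v \<in> lists I" "t \<in> I" "u \<sim> v @ [t]" "len u = Suc (len v)"
      using last_descent less.prems(1) by blast
    note s = less.prems(2)
    have us: "len (u @ [s]) = len (v @ [t, s])"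
      using len_cong[OF eqv_lists_append_cong(1)[OF vt(3), of "[s]"]] s by simp
    have act_u: "act u (unit_vec s) = act v (refl t (unit_vec s) :: 'i \<Rightarrow> int)"
      using act_cong[OF vt(3)] by simp
    have "s \<noteq> t"
      using us less.prems(3) len_snoc_snoc[OF vt(1,2)] vt(4) by auto
    have v_t: "nonneg (act v (unit_vec t))"
      using less.hyps[of v t] vt len_cong[OF vt(3)] by simp
    show ?thesis
    proof (cases "m s t = 3")
      case False
      then have m2: "m t s = 2" using off_diag[OF s vt(2) \<open>s \<noteq> t\<close>] sym by metis
      have "[t, s] \<sim> [s, t]"
      proof (subst eqv_iff_rev_append)
        show "rev [s, t] @ [t, s] \<sim> []"
          using cox_rel[of t I s "[]" "[]" m] m2 s vt(2)  by (simp add: numeral_eq_Suc)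
      qed (use s vt in auto)
      then have "v @ [t, s] \<sim> v @ [s] @ [t]"
        using eqv_lists_append_cong(2) vt(1) by fastforce
      then have "len (u @ [s]) \<le> Suc (len (v @ [s]))"
        using us len_cong len_snoc_le[of "v @ [s]" t] s vt by simp
      then have "nonneg (act v (unit_vec s))"
        using less.hyps[of v s] less.prems(3) vt s by simp
      then show ?thesis using act_u False by (simp add: refl_unit[OF s vt(2) \<open>s \<noteq> t\<close>])
    next
      case True
      then have act_u': "act u (unit_vec s) = (\<lambda>k. act v (unit_vec s) k + act v (unit_vec t) k :: int)"
        using act_u by (simp add: refl_unit[OF s vt(2) \<open>s \<noteq> t\<close>] act_add)
      show ?thesis
      proof (cases "len v \<le> len (v @ [s])")
        case True
        then have "nonneg (act v (unit_vec s))" using less.hyps[of v s] vt s by simp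
        then show ?thesis using act_u' v_t by (simp add: nonneg_def)
      next
        case False
        \<comment> \<open>Here \<open>s\<close> shortens \<open>v\<close>, so \<open>v = x s\<close>
          in the group, and \<open>t s = s t s t\<close> turns \<open>u s\<close> into
          \<open>x t s t\<close>. As \<open>len u = len x + 2\<close>, the hypothesis forces
          \<open>len x \<le> len (x @ [t])\<close>; moreover \<open>act x (unit_vec t)\<close>
          equals \<open>act u (unit_vec s)\<close>.\<close>
        define x where "x = v @ [s]"
        have x: "x \<in> lists I" "len v = Suc (len x)"
          using False len_le_snoc[OF vt(1) s] vt(1) s by (simp_all add: x_def)
        have "v @ [t, s] \<sim> x @ [t, s, t]"
        proof -
          have "[t, s] \<sim> [s, t, s, t]"
          proof (subst eqv_iff_rev_append)
            show "rev [s, t, s, t] @ [t, s] \<sim> []"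
              using cox_rel[of t I s "[]" "[]" m] True s vt(2) sym[of t s]
              by (simp add: numeral_eq_Suc)
          qed (use s vt in auto)
          then show ?thesis using eqv_lists_append_cong(2)[OF _ vt(1)] by (fastforce simp: x_def)
        qed
        then have "len (u @ [s]) = len ((x @ [t]) @ [s] @ [t])" using us len_cong by simp
        also have "\<dots> \<le> Suc (Suc (len (x @ [t])))"
          using len_snoc_le[of "x @ [t, s]" t] len_snoc_le[of "x @ [t]" s] x(1) s vt(2) by simp
        finally have "nonneg (act x (unit_vec t))"
          using less.hyps[of x t] less.prems(3) vt x by simp
        moreover have "act x (unit_vec t) = (\<lambda>k. act v (unit_vec s) k + act v (unit_vec t) k :: int)"
          using \<open>s \<noteq> t\<close> True sym[of t s]
          by (simp add: refl_unit[OF vt(2) s] x_def act_add add.commute)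
        ultimately show ?thesis using act_u' by simp
      qed
    qed
  qed
qed

lemma nonpos_if_len_less:
  assumes "u \<in> lists I" "s \<in> I" "len (u @ [s]) < len u"
  shows "nonneg (\<lambda>k. - act u (unit_vec s) k)"
proof -
  have "nonneg (act (u @ [s]) (unit_vec s))"
    using nonneg_if_len_le[of "u @ [s]" s] len_snoc_snoc[of u s] assms by simp
  then show ?thesis by (simp add: refl_unit_self[OF assms(2)] act_minus)
qed

lemma act_rev_act:
  assumes "u \<in> lists I"
  shows "act (rev u) (act u v) = v" "act u (act (rev u) v) = v"
  using act_cong[OF rev_cancel[OF assms], of v] act_cong[OF rev_cancel'[OF assms], of v] by simp_all

lemma act_unit_nonzero:
  assumes "u \<in> lists I"
  shows "act u (unit_vec s) \<noteq> (\<lambda>k. 0 :: int)"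
proof
  assume "act u (unit_vec s) = (\<lambda>k. 0 :: int)"
  then have "unit_vec s = act (rev u) (\<lambda>k. 0 :: int)" using act_rev_act(1)[OF assms] by metis
  then have "unit_vec s s = (0 :: int)" by (simp add: act_zero)
  then show False by (simp add: unit_vec_def)
qed

lemma root_sign:
  assumes "u \<in> lists I" "s \<in> I"
  shows "nonneg (act u (unit_vec s)) \<or> nonneg (\<lambda>k. - act u (unit_vec s) k)"
  using nonneg_if_len_le[OF assms] nonpos_if_len_less[OF assms] by linarith

lemma root_not_both:
  assumes "u \<in> lists I" "nonneg (act u (unit_vec s))" "nonneg (\<lambda>k. - act u (unit_vec s) k)"
  shows False
  using assms act_unit_nonzero[OF assms(1), of s] by (force simp: nonneg_def fun_eq_iff intro: antisym)

lemma len_snoc_nonneg: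
  assumes "u \<in> lists I" "s \<in> I" "nonneg (act u (unit_vec s))"
  shows "len (u @ [s]) = Suc (len u)"
proof -
  have "len u \<le> len (u @ [s])"
    using nonpos_if_len_less root_not_both assms by (metis not_le)
  moreover have "len (u @ [s]) \<noteq> len u"
  proof
    assume "len (u @ [s]) = len u"
    then have "nonneg (act (u @ [s]) (unit_vec s))"
      using nonneg_if_len_le[of "u @ [s]" s] len_snoc_snoc[of u s] assms by simp
    then show False using assms root_not_both by (simp add: refl_unit_self[OF assms(2)] act_minus)
  qed
  ultimately show ?thesis using len_snoc_le[OF assms(1,2)] by simp
qed

lemma len_snoc_nonpos:
  assumes "u \<in> lists I" "s \<in> I" "nonneg (\<lambda>k. - act u (unit_vec s) k)"
  shows "len u = Suc (len (u @ [s]))"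
proof -
  have "nonneg (act (u @ [s]) (unit_vec s))"
    using assms by (simp add: refl_unit_self[OF assms(2)] act_minus)
  then show ?thesis using len_snoc_nonneg[of "u @ [s]" s] len_snoc_snoc[of u s] assms by simp
qed

text \<open>The last letter of a reduced word of a nontrivial element shortens it, whereas a
  nonnegative image of that simple root would lengthen it.\<close>

lemma trivial_if_nonneg:
  assumes "u \<in> lists I" "\<And>s. s \<in> I \<Longrightarrow> nonneg (act u (unit_vec s))"
  shows "u \<sim> []"
proof (rule ccontr)
  assume "\<not> u \<sim> []"
  then have "len u \<noteq> 0" using len_0 assms(1) by blast
  then obtain v t where vt: "v \<in> lists I" "t \<in> I" "u \<sim> v @ [t]" "len u = Suc (len v)"
    using last_descent assms(1) by blast
  have "len (u @ [t]) = len (v @ [t, t])"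
    using len_cong[OF eqv_lists_append_cong(1)[OF vt(3), of "[t]"]] vt(2) by simp
  then have "len (u @ [t]) < len u" using len_snoc_snoc vt by simp
  then show False using len_snoc_nonneg assms vt(2) by fastforce
qed

text \<open>Faithfulness of the action: if \<open>u\<close> and \<open>v\<close> agree on the simple
  roots, then \<open>rev v @ u\<close> fixes them all and has no descent.\<close>

lemma eqv_iff_act:
  assumes "u \<in> lists I" "v \<in> lists I"
  shows "u \<sim> v \<longleftrightarrow> (\<forall>s\<in>I. act u (unit_vec s) = (act v (unit_vec s) :: 'i \<Rightarrow> int))"
proof
  assume "\<forall>s\<in>I. act u (unit_vec s) = (act v (unit_vec s) :: 'i \<Rightarrow> int)"
  then have "nonneg (act (rev v @ u) (unit_vec s))" if "s \<in> I" for s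
    using that by (simp add: act_rev_act(1)[OF assms(2)]) (simp add: nonneg_def unit_vec_def)
  then have "rev v @ u \<sim> []" using trivial_if_nonneg[of "rev v @ u"] assms rev_lists by simp
  then show "u \<sim> v" using eqv_iff_rev_append assms by blast
qed (use act_cong in blast)

lemma root_supported:
  assumes "u \<in> lists J" "s \<in> J" "k \<notin> J"
  shows "act u (unit_vec s) k = 0"
  by (subst act_inside[OF assms(1,3)]) (use assms(2,3) in \<open>auto simp: unit_vec_def\<close>)

subsection \<open>Longest elements\<close>

text \<open>Let \<beta> be the image of the simple root \<open>s\<close> under
  \<open>rev w @ y\<close>, so that \<open>act w \<beta>\<close> is its image under
  \<open>y\<close>. Since \<beta> is supported on \<open>J\<close> and \<open>w\<close> reverses the
  sign of such vectors, appending \<open>s\<close> lengthens one of \<open>y\<close> and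
  \<open>rev w @ y\<close> and shortens the other.\<close>

lemma len_rev_append:
  assumes J: "J \<subseteq> I" and w: "w \<in> lists J" and neg: "\<And>s. s \<in> J \<Longrightarrow> nonneg (\<lambda>k. - act w (unit_vec s) k)"
    and y: "y \<in> lists J"
  shows "len y + len (rev w @ y) = len w"
proof -
  have wI: "w \<in> lists I" using w J by auto
  have finJ: "finite J" by (rule finite_subset[OF J]) simp
  have flip: "nonneg (\<lambda>k. - act w v k)" if "nonneg v" "\<And>k. k \<notin> J \<Longrightarrow> v k = 0" for v
  proof -
    have "0 \<le> (\<Sum>j\<in>J. v j * - act w (unit_vec j) k)" for k
      using that neg by (intro sum_nonneg mult_nonneg_nonneg) (auto simp: nonneg_def)
    then show ?thesis by (simp add: act_decomp[OF finJ that(2)] nonneg_def sum_negf)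
  qed
  show ?thesis using y
  proof (induction y rule: rev_induct)
    case Nil
    then show ?case using len_rev[OF wI] by simp
  next
    case (snoc s y)
    then have s: "s \<in> J" "s \<in> I" and yJ: "y \<in> lists J" and yI: "y \<in> lists I"
      and IH: "len y + len (rev w @ y) = len w" using J by auto
    have z: "rev w @ y \<in> lists I" using rev_lists[OF wI] yI by simp
    define \<beta> where "\<beta> = (act (rev w @ y) (unit_vec s) :: 'i \<Rightarrow> int)"
    have supp: "\<beta> k = 0" if "k \<notin> J" for k
      unfolding \<beta>_def
      by (rule root_supported[OF _ s(1) that]) (use w yJ in auto)
    have w\<beta>: "act w \<beta> = act y (unit_vec s)"
      by (simp add: \<beta>_def act_rev_act(2)[OF wI])
    from root_sign[OF yI s(2)] show ?case
    proof
      assume y_pos: "nonneg (act y (unit_vec s))"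
      then have "\<not> nonneg \<beta>"
        using flip[of \<beta>] supp w\<beta> root_not_both[OF yI] by metis
      then have "nonneg (\<lambda>k. - \<beta> k)" using root_sign[OF z s(2)] by (simp add: \<beta>_def)
      then have "len (rev w @ y) = Suc (len (rev w @ y @ [s]))"
        using len_snoc_nonpos[OF z s(2)] by (simp add: \<beta>_def)
      then show ?thesis using len_snoc_nonneg[OF yI s(2) y_pos] IH by simp
    next
      assume y_neg: "nonneg (\<lambda>k. - act y (unit_vec s) k)"
      have "\<not> nonneg (\<lambda>k. - \<beta> k)"
        using flip[of "\<lambda>k. - \<beta> k"] supp w\<beta> root_not_both[OF yI _ y_neg] by (auto simp: act_minus)
      then have "nonneg \<beta>" using root_sign[OF z s(2)] by (simp add: \<beta>_def)
      then have "len (rev w @ y @ [s]) = Suc (len (rev w @ y))"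
        using len_snoc_nonneg[OF z s(2)] by (simp add: \<beta>_def)
      then show ?thesis using len_snoc_nonpos[OF yI s(2) y_neg] IH by simp
    qed
  qed
qed

text \<open>By \<open>len_rev_append\<close> no \<open>y\<close> is longer than \<open>w\<close>,
  and equal length leaves length 0 for \<open>rev w @ y\<close>, so the maximum is unique. A
  candidate need only be tested on the simple roots of \<open>J\<close>.\<close>

lemma longest_element_eq:
  assumes J: "J \<subseteq> I" and w: "w \<in> lists J" and neg: "\<And>s. s \<in> J \<Longrightarrow> nonneg (\<lambda>k. - act w (unit_vec s) k)"
  shows "longest_element (cls ` lists J) = cls w"
  unfolding longest_element_def
proof (rule the_equality)
  have sum_eq: "len y + len (rev w @ y) = len w" if "y \<in> lists J" for y
    using len_rev_append[OF J w _ that] neg by blast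
  have wI: "w \<in> lists I" using w J by auto
  show "cls w \<in> cls ` lists J \<and> (\<forall>y\<in>cls ` lists J. cox_length y \<le> cox_length (cls w))"
    using w sum_eq le_add1 by (metis (no_types, lifting) imageE imageI)
  fix x assume x: "x \<in> cls ` lists J \<and> (\<forall>y\<in>cls ` lists J. cox_length y \<le> cox_length x)"
  then obtain y where y: "x = cls y" "y \<in> lists J" by blast
  then have yI: "y \<in> lists I" using J by auto
  have "len w \<le> len y" using x w y(1) by (metis imageI)
  then have "len (rev w @ y) = 0" using sum_eq[OF y(2)] by simp
  then have "rev w @ y \<sim> []" using len_0[of "rev w @ y"] rev_lists[OF wI] yI by simp
  then have "y \<sim> w" using eqv_iff_rev_append[OF yI wI] by simp
  then show "x = cls w" using cox_class_eq_iff[OF yI] y(1) by blast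
qed

subsection \<open>The group\<close>

lemma group_W: "group W"
  by (rule group_coxeter_group) simp

lemma carrier_W: "carrier W = cls ` lists I"
  by (simp add: coxeter_group_def)

lemma one_W: "\<one>\<^bsub>W\<^esub> = cls []"
  by (simp add: coxeter_group_def)

lemmas mult_W = coxeter_group_mult[of _ I _ m]

lemma cls_eq_iff: "u \<in> lists I \<Longrightarrow> cls u = cls v \<longleftrightarrow> u \<sim> v"
  by (rule cox_class_eq_iff)

lemma inv_W:
  assumes "u \<in> lists I"
  shows "inv\<^bsub>W\<^esub> cls u = cls (rev u)"
proof (rule group.inv_equality[OF group_W])
  show "cls (rev u) \<otimes>\<^bsub>W\<^esub> cls u = \<one>\<^bsub>W\<^esub>"
    using rev_cancel[OF assms] rev_lists[OF assms] assms cls_eq_iff[of "rev u @ u"]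
    by (simp add: mult_W one_W)
qed (use assms rev_lists carrier_W in auto)

lemma parabolic_eq:
  assumes "J \<subseteq> I"
  shows "parabolic I m J = cls ` lists J"
proof -
  interpret group W by (rule group_W)
  show ?thesis
  proof
    show "parabolic I m J \<subseteq> cls ` lists J"
    proof
      fix x assume "x \<in> parabolic I m J"
      then show "x \<in> cls ` lists J" unfolding parabolic_def
      proof (induction rule: generate.induct)
        case one
        then show ?case by (auto simp: one_W)
      next
        case (incl h)
        then show ?case by (auto simp: cox_gen_def)
      next
        case (inv h)
        then obtain j where "j \<in> J" "h = cls [j]" by (auto simp: cox_gen_def)
        then show ?case using inv_W[of "[j]"] assms by auto
      next
        case (eng h1 h2)
        then obtain u v where "u \<in> lists J" "h1 = cls u" "v \<in> lists J" "h2 = cls v" by blast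
        moreover from this have "u \<in> lists I" "v \<in> lists I" using assms by auto
        ultimately show ?case using mult_W[of u v] by (metis append_in_lists_conv imageI)
      qed
    qed
    show "cls ` lists J \<subseteq> parabolic I m J"
    proof
      fix x assume "x \<in> cls ` lists J"
      then obtain u where "u \<in> lists J" "x = cls u" by blast
      moreover have "cls u \<in> parabolic I m J" if "u \<in> lists J" for u
        using that
      proof (induction u)
        case Nil
        then show ?case using generate.one[of W] by (simp add: one_W parabolic_def)
      next
        case (Cons j u)
        then have "cox_gen I m j \<otimes>\<^bsub>W\<^esub> cls u \<in> parabolic I m J"
          unfolding parabolic_def using generate.eng[OF generate.incl] by (metis Cons_in_lists_iff imageI)
        moreover have "[j] \<in> lists I" "u \<in> lists I" using Cons assms by auto
        ultimately show ?case using mult_W[of "[j]" u] by (simp add: cox_gen_def)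
      qed
      ultimately show "x \<in> parabolic I m J" by simp
    qed
  qed
qed

lemma conj_class_W:
  assumes "u \<in> lists I"
  shows "conj_class W (cls u) = {cls (g @ u @ rev g) | g. g \<in> lists I}"
proof -
  have "cls g \<otimes>\<^bsub>W\<^esub> cls u \<otimes>\<^bsub>W\<^esub> inv\<^bsub>W\<^esub> (cls g) = cls (g @ u @ rev g)" if "g \<in> lists I" for g
    using that assms rev_lists by (simp add: inv_W mult_W)
  then show ?thesis unfolding conj_class_def carrier_W by blast
qed

lemma conj_class_cls_eqI:
  assumes "u \<in> lists I" "v \<in> lists I" "g \<in> lists I" "g @ u \<sim> v @ g"
  shows "conj_class W (cls u) = conj_class W (cls v)"
proof (rule conj_class_eqI[OF group_W])
  show "cls g \<otimes>\<^bsub>W\<^esub> cls u = cls v \<otimes>\<^bsub>W\<^esub> cls g"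
    using assms cls_eq_iff[of "g @ u" "v @ g"] by (simp add: mult_W)
qed (use assms carrier_W in auto)

lemma conj_class_cls_eqD:
  assumes "u \<in> lists I" "v \<in> lists I" "conj_class W (cls u) = conj_class W (cls v)"
  obtains g where "g \<in> lists I" "v \<sim> g @ u @ rev g"
proof -
  have "cls ([] @ v @ rev []) \<in> conj_class W (cls v)" unfolding conj_class_W[OF assms(2)] by blast
  then have "cls v \<in> {cls (g @ u @ rev g) | g. g \<in> lists I}"
    using assms(3) conj_class_W[OF assms(1)] by simp
  then obtain g where "g \<in> lists I" "cls v = cls (g @ u @ rev g)" by blast
  then show thesis using that cls_eq_iff[OF assms(2)] by blast
qed

lemma involutions_W: "involutions W = {cls u | u. u \<in> lists I \<and> u @ u \<sim> []}"
proof -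
  have "cls u \<otimes>\<^bsub>W\<^esub> cls u = \<one>\<^bsub>W\<^esub> \<longleftrightarrow> u @ u \<sim> []" if "u \<in> lists I" for u
    using that cls_eq_iff[of "u @ u" "[]"] by (simp add: mult_W one_W)
  then show ?thesis unfolding involutions_def carrier_W by blast
qed

subsection \<open>Involutions\<close>

text \<open>After Richardson: if \<open>s\<close> is a descent of the involution \<open>u\<close> and does not commute with \<open>u\<close>,
  then \<open>s u s\<close> is shorter than \<open>u\<close>.\<close>

lemma involution_conj_minimal:
  assumes "u \<in> lists I" "u @ u \<sim> []"
  shows "\<exists>v\<in>lists I. v @ v \<sim> [] \<and> conj_class W (cls v) = conj_class W (cls u) \<and>
    (\<forall>s\<in>I. nonneg (\<lambda>k. - act v (unit_vec s) k) \<longrightarrow> act v (unit_vec s) = (\<lambda>k. - unit_vec s k :: int))"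
  using assms
proof (induction "len u" arbitrary: u rule: less_induct)
  case less
  note u = less.prems
  show ?case
  proof (cases "\<forall>s\<in>I. nonneg (\<lambda>k. - act u (unit_vec s) k)
      \<longrightarrow> act u (unit_vec s) = (\<lambda>k. - unit_vec s k :: int)")
    case True
    then show ?thesis using u by blast
  next
    case False
    then obtain s where s: "s \<in> I" "nonneg (\<lambda>k. - act u (unit_vec s) k)"
      and ne: "act u (unit_vec s) \<noteq> (\<lambda>k. - unit_vec s k :: int)" by blast
    define \<beta> where "\<beta> = (act u (unit_vec s) :: 'i \<Rightarrow> int)"
    have u\<beta>: "act u \<beta> = unit_vec s" using act_cong[OF u(2), of "unit_vec s"] by (simp add: \<beta>_def)
    have su: "s # u \<in> lists I" using s u by simp
    have "rev u \<sim> u"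
      using eqv_iff_rev_append[OF rev_lists[OF u(1)] u(1)] eqv_rev[OF u(2)] by simp
    then have "len (s # u) = len (u @ [s])"
      using len_cong[OF eqv_lists_append_cong(2), of "rev u" u "[s]"] s(1)
        len_rev[of "u @ [s]"] u(1) by simp
    then have len_su: "len u = Suc (len (s # u))" using len_snoc_nonpos[OF u(1) s] by simp
    \<comment> \<open>\<open>refl s\<close> changes coordinate \<open>s\<close> alone, so if it made
      the nonpositive \<beta> nonnegative, \<beta> would be a multiple of the simple root
      \<open>s\<close>. By \<open>u u = 1\<close> the factor squares to 1, so it is -1, against the
      choice of \<open>s\<close>.\<close>
    have "\<not> nonneg (refl s \<beta>)"
    proof
      assume "nonneg (refl s \<beta>)"
      then have "0 \<le> \<beta> k" if "k \<noteq> s" for k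
        using that by (auto simp: nonneg_def refl_def split: if_splits dest: spec[of _ k])
      moreover have le0: "\<beta> k \<le> 0" for k using s(2) by (simp add: nonneg_def \<beta>_def)
      ultimately have \<beta>: "\<beta> = (\<lambda>k. \<beta> s * unit_vec s k)"
        by (auto simp: fun_eq_iff unit_vec_def intro: antisym)
      have "act u \<beta> = (\<lambda>k. \<beta> s * \<beta> k)"
        by (subst \<beta>) (simp add: act_scale \<beta>_def)
      then have "\<beta> s * \<beta> s = 1" using fun_cong[of _ _ s] u\<beta> by (metis unit_vec_def)
      then have "\<beta> s = -1" using le0[of s] by (simp add: zmult_eq_1_iff)
      then show False using ne \<beta> by (simp add: \<beta>_def)
    qed
    then have "nonneg (\<lambda>k. - act (s # u) (unit_vec s) k)"
      using root_sign[OF su s(1)] by (simp add: \<beta>_def)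
    then have "len (s # u @ [s]) < len u" using len_snoc_nonpos[OF su s(1)] len_su by simp
    moreover have sus: "s # u @ [s] \<in> lists I" using s u by simp
    moreover have "(s # u @ [s]) @ (s # u @ [s]) \<sim> []"
      using s u by (subst eqv_iff_act) (simp_all add: refl_refl act_cong[OF u(2), simplified])
    ultimately obtain v where v: "v \<in> lists I" "v @ v \<sim> []"
      "conj_class W (cls v) = conj_class W (cls (s # u @ [s]))"
      "\<forall>s\<in>I. nonneg (\<lambda>k. - act v (unit_vec s) k) \<longrightarrow> act v (unit_vec s) = (\<lambda>k. - unit_vec s k :: int)"
      using less.hyps[of "s # u @ [s]"] by blast
    have "conj_class W (cls u) = conj_class W (cls (s # u @ [s]))"
      by (rule conj_class_cls_eqI[OF u(1) sus, of "[s]"])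
        (use s u snoc_snoc[of "s # u" s] cox_sym in \<open>auto simp: refl_refl\<close>)
    then show ?thesis using v by auto
  qed
qed

text \<open>The product \<open>w v\<close> has no descent. On \<open>J\<close> the two signs cancel.
  For \<open>s\<close> outside \<open>J\<close> the image \<beta> under \<open>v\<close> is
  nonnegative and not supported on \<open>J\<close>, since otherwise \<open>v\<close> would negate
  it and \<beta> would be minus the simple root \<open>s\<close>; its positive coordinate outside
  \<open>J\<close> is untouched by \<open>w\<close>. Thus \<open>w v = 1\<close>, and
  \<open>v v = 1\<close> gives \<open>v = w\<close>.\<close>

lemma minimal_involution_eqv_longest:
  assumes v: "v \<in> lists I" "v @ v \<sim> []" and J: "J \<subseteq> I"
    and act_J: "\<And>s. s \<in> J \<Longrightarrow> act v (unit_vec s) = (\<lambda>k. - unit_vec s k :: int)"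
    and pos: "\<And>s. s \<in> I \<Longrightarrow> s \<notin> J \<Longrightarrow> \<not> nonneg (\<lambda>k. - act v (unit_vec s) k)"
    and w: "w \<in> lists J" and neg: "\<And>s. s \<in> J \<Longrightarrow> nonneg (\<lambda>k. - act w (unit_vec s) k)"
  shows "v \<sim> w"
proof -
  have wI: "w \<in> lists I" and wv: "w @ v \<in> lists I" using w v J by auto
  have finJ: "finite J" by (rule finite_subset[OF J]) simp
  have "nonneg (act (w @ v) (unit_vec s))" if s: "s \<in> I" for s
  proof (cases "s \<in> J")
    case True
    then show ?thesis using neg by (simp add: act_J act_minus)
  next
    case False
    define \<beta> where "\<beta> = (act v (unit_vec s) :: 'i \<Rightarrow> int)"
    have \<beta>: "nonneg \<beta>" using root_sign[OF v(1) s] pos[OF s False] by (simp add: \<beta>_def)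
    have v\<beta>: "act v \<beta> = unit_vec s" using act_cong[OF v(2), of "unit_vec s"] by (simp add: \<beta>_def)
    have "\<exists>k. k \<notin> J \<and> \<beta> k \<noteq> 0"
    proof (rule ccontr)
      assume "\<not> (\<exists>k. k \<notin> J \<and> \<beta> k \<noteq> 0)"
      then have supp: "\<And>k. k \<notin> J \<Longrightarrow> \<beta> k = 0" by blast
      have "act v \<beta> = (\<lambda>k. - \<beta> k)"
      proof
        fix k
        have "act v \<beta> k = - (\<Sum>j\<in>J. \<beta> j * unit_vec j k)"
          using act_decomp[of J \<beta> v] finJ supp by (simp add: act_J sum_negf)
        then show "act v \<beta> k = - \<beta> k"
          using fun_cong[OF unit_decomp[of J \<beta>], of k] finJ supp by simp
      qed
      then have "\<beta> s = -1" using v\<beta> fun_cong[of _ _ s] by (metis minus_minus unit_vec_def)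
      then show False using \<beta> by (auto simp: nonneg_def dest: spec[of _ s])
    qed
    then obtain k where "k \<notin> J" "0 < \<beta> k" using \<beta> by (metis nonneg_def order_le_less)
    then have "0 < (act (w @ v) (unit_vec s) k :: int)" by (simp add: \<beta>_def act_inside[OF w])
    then show ?thesis using root_sign[OF wv s] by (auto simp: nonneg_def dest: spec[of _ k])
  qed
  then have "w @ v \<sim> []" using trivial_if_nonneg[OF wv] by blast
  then have "act w (act v x) = x" for x :: "'i \<Rightarrow> int" using act_cong[of "w @ v" "[]" x] by simp
  moreover have "act v (act v x) = x" for x :: "'i \<Rightarrow> int" using act_cong[OF v(2), of x] by simp
  ultimately have "act v x = act w x" for x :: "'i \<Rightarrow> int" by metis
  then show ?thesis using eqv_iff_act[OF v(1) wI] by simp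
qed

subsection \<open>The reflection representation\<close>

text \<open>For the labels 1, 2 and 3 the cosines are -1, 0 and 1/2, so the real form is half the
  integral pairing.\<close>

lemma simple_reflection_eq_refl:
  assumes "i \<in> I"
  shows "simple_reflection I m i v = refl i v"
proof -
  have "- cos (pi / real (m i j)) * v j = (if j = i then v i else 0) - (if m i j = 3 then v j else 0) / 2"
    if "j \<in> I" for j
    using off_diag[OF assms that] assms by (cases "i = j") (auto simp: cos_60)
  then have "(\<Sum>j\<in>I. - cos (pi / real (m i j)) * v j) = v i - nbr_sum i v / 2"
    using assms by (simp add: nbr_sum_def sum_subtractf sum_divide_distrib cong: sum.cong)
  then show ?thesis by (simp only: simple_reflection_def refl_def) (simp add: algebra_simps)
qed

lemma reflection_rep_cls:
  assumes "u \<in> lists I"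
  shows "reflection_rep I m (cls u) v = act u v"
proof -
  have "(SOME w. w \<in> cls u) \<in> cls u"
    by (rule someI[of _ u]) (simp only: cox_class_def mem_Collect_eq cox_refl[OF assms])
  then have w: "u \<sim> (SOME w. w \<in> cls u)" by (simp add: cox_class_def)
  have "foldr (simple_reflection I m) w v = act w v" if "w \<in> lists I" for w
    using that by (induction w) (simp_all add: simple_reflection_eq_refl)
  then show ?thesis using w eqv_lists(2)[OF w] act_cong[OF w, of v]
    unfolding reflection_rep_def by metis
qed

lemma act_of_int: "act u (\<lambda>k. of_int (v k)) = (\<lambda>k. of_int (act u v k))"
  by (induction u) (auto simp: refl_def nbr_sum_def fun_eq_iff if_distrib[of of_int] cong: if_cong)

lemma act_cong_on:
  assumes "\<And>k. k \<in> I \<Longrightarrow> v k = v' k" "k \<in> I"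
  shows "act u v k = act u v' k"
  using assms(2)
proof (induction u arbitrary: k)
  case (Cons i u)
  have "nbr_sum i (act u v) = nbr_sum i (act u v')"
    unfolding nbr_sum_def by (rule sum.cong) (use Cons.IH in auto)
  then show ?case using Cons by (auto simp: refl_def)
qed (use assms in simp)

lemma act_eq_minus:
  fixes v :: "'i \<Rightarrow> 'a::comm_ring_1"
  assumes "\<And>s. s \<in> I \<Longrightarrow> act u (unit_vec s) = (\<lambda>k. - unit_vec s k :: int)" "i \<in> I"
  shows "act u v i = - v i"
proof -
  \<comment> \<open>A vector may take any values outside \<open>I\<close>, where the expansion in
    unit vectors fails; by \<open>act_cong_on\<close> the truncation does not affect the coordinates
    in \<open>I\<close>.\<close>
  define v' where "v' k = (if k \<in> I then v k else 0)" for k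
  have "unit_vec s = (\<lambda>k. of_int (unit_vec s k) :: 'a)" for s :: 'i
    by (auto simp: unit_vec_def)
  then have "act u (unit_vec s) = (\<lambda>k. - unit_vec s k :: 'a)" if "s \<in> I" for s
    using act_of_int[of u "unit_vec s"] assms(1)[OF that] by simp
  then have "act u v' i = - (\<Sum>j\<in>I. v' j * unit_vec j i)"
    using act_decomp[of I v' u] by (simp add: v'_def sum_negf)
  also have "\<dots> = - v' i" using unit_decomp[of I v'] by (simp add: v'_def fun_eq_iff)
  finally show ?thesis using act_cong_on[of v v' i u] assms(2) by (simp add: v'_def)
qed

subsection \<open>Heights\<close>

definition height :: "('i \<Rightarrow> int) \<Rightarrow> ('i \<Rightarrow> int) \<Rightarrow> int" where
  "height \<omega> v = (\<Sum>k\<in>I. \<omega> k * v k)"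

lemma height_unit: "s \<in> I \<Longrightarrow> height \<omega> (unit_vec s) = \<omega> s"
  by (simp add: height_def unit_vec_def if_distrib[of "\<lambda>x. _ * x"] cong: if_cong)

lemma height_add: "height \<omega> (\<lambda>k. v k + w k) = height \<omega> v + height \<omega> w"
  by (simp add: height_def algebra_simps sum.distrib)

lemma height_minus: "height \<omega> (\<lambda>k. - v k) = - height \<omega> v"
  by (simp add: height_def sum_negf)

lemma height_sum: "height \<omega> (\<lambda>k. \<Sum>j\<in>A. c j * f j k) = (\<Sum>j\<in>A. c j * height \<omega> (f j))"
  unfolding height_def sum_distrib_left by (subst sum.swap) (simp add: mult.left_commute)

lemma height_nonneg: "(\<And>k. k \<in> I \<Longrightarrow> 0 < \<omega> k) \<Longrightarrow> nonneg v \<Longrightarrow> 0 \<le> height \<omega> v"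
  unfolding height_def nonneg_def by (intro sum_nonneg mult_nonneg_nonneg) (simp_all add: less_imp_le)

text \<open>Since every root has a sign, one integer is enough to detect it.\<close>

lemma root_sign_height:
  assumes "u \<in> lists I" "s \<in> I" "\<And>k. k \<in> I \<Longrightarrow> 0 < \<omega> k"
  shows "0 < height \<omega> (act u (unit_vec s)) \<Longrightarrow> nonneg (act u (unit_vec s))"
    and "height \<omega> (act u (unit_vec s)) < 0 \<Longrightarrow> nonneg (\<lambda>k. - act u (unit_vec s) k)"
proof -
  have "nonneg v \<Longrightarrow> 0 \<le> height \<omega> v" for v by (rule height_nonneg) (rule assms(3))
  from this[of "act u (unit_vec s)"] this[of "\<lambda>k. - act u (unit_vec s) k"]
  show "0 < height \<omega> (act u (unit_vec s)) \<Longrightarrow> nonneg (act u (unit_vec s))"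
    and "height \<omega> (act u (unit_vec s)) < 0 \<Longrightarrow> nonneg (\<lambda>k. - act u (unit_vec s) k)"
    using root_sign[OF assms(1,2)] by (auto simp: height_minus)
qed

lemma height_snoc:
  assumes "s \<in> I" "t \<in> I"
  shows "height \<omega> (act (u @ [t]) (unit_vec s)) =
    (if s = t then - height \<omega> (act u (unit_vec t))
     else if m s t = 3 then height \<omega> (act u (unit_vec s)) + height \<omega> (act u (unit_vec t))
     else height \<omega> (act u (unit_vec s)))"
  using assms
  by (simp add: refl_unit refl_unit_self act_add act_minus height_add height_minus)

text \<open>Only the identity fixes a strictly dominant functional.\<close>

lemma eqv_if_height_eq:
  assumes u: "u \<in> lists I" and v: "v \<in> lists I" and pos: "\<And>k. k \<in> I \<Longrightarrow> 0 < \<omega> k"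
    and eq: "\<And>s. s \<in> I \<Longrightarrow> height \<omega> (act u (unit_vec s)) = height \<omega> (act v (unit_vec s))"
  shows "u \<sim> v"
proof -
  have uv: "u @ rev v \<in> lists I" using u rev_lists[OF v] by simp
  have "nonneg (act (u @ rev v) (unit_vec s))" if s: "s \<in> I" for s
  proof (rule root_sign_height(1)[OF uv s pos])
    define x where "x = (act (rev v) (unit_vec s) :: 'i \<Rightarrow> int)"
    have supp: "x k = 0" if "k \<notin> I" for k
      unfolding x_def by (rule root_supported[OF rev_lists[OF v] s that])
    have "height \<omega> (act w x) = (\<Sum>j\<in>I. x j * height \<omega> (act w (unit_vec j)))" for w
      using act_decomp[of I x w] supp by (simp add: height_sum)
    \<comment> \<open>Agreement on the simple roots extends linearly, and \<open>act v x\<close> is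
      the simple root \<open>s\<close> itself, whose height \<open>\<omega> s\<close> is
      positive.\<close>
    then have "height \<omega> (act u x) = height \<omega> (act v x)" using eq by simp
    then show "0 < height \<omega> (act (u @ rev v) (unit_vec s))"
      using pos[OF s] by (simp add: x_def act_rev_act(2)[OF v] height_unit[OF s])
  qed
  then have "u @ rev v \<sim> []" using trivial_if_nonneg[OF uv] by blast
  then have triv: "act u (act (rev v) x) = x" for x :: "'i \<Rightarrow> int"
    using act_cong[of "u @ rev v" "[]" x] by simp
  have "act u x = act v x" for x :: "'i \<Rightarrow> int"
    using triv[of "act v x"] by (simp add: act_rev_act(1)[OF v])
  then show ?thesis using eqv_iff_act[OF u v] by simp
qed

text \<open>Commutation makes the image of the simple root \<open>s\<close> a -1 eigenvector of
  \<open>refl s\<close>, hence a multiple of that root; the height then fixes the factor.\<close>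

lemma act_unit_minus_if_commutes:
  assumes "u @ [s] \<sim> s # u" "s \<in> I" "height \<omega> (act u (unit_vec s)) = - \<omega> s" "0 < \<omega> s"
  shows "act u (unit_vec s) = (\<lambda>k. - unit_vec s k :: int)"
proof -
  define \<beta> where "\<beta> = (act u (unit_vec s) :: 'i \<Rightarrow> int)"
  have "refl s \<beta> = (\<lambda>k. - \<beta> k)"
    using act_cong[OF assms(1), of "unit_vec s :: 'i \<Rightarrow> int"]
    by (simp add: \<beta>_def refl_unit_self[OF assms(2)] act_minus)
  then have "refl s \<beta> k = - \<beta> k" for k by simp
  then have "\<beta> k = 0" if "k \<noteq> s" for k
    using that by (auto simp: refl_def dest!: meta_spec[of _ k])
  then have \<beta>: "\<beta> = (\<lambda>k. \<beta> s * unit_vec s k)" by (auto simp: unit_vec_def fun_eq_iff)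
  have "height \<omega> \<beta> = \<beta> s * \<omega> s"
    using height_sum[of \<omega> "\<lambda>_. \<beta> s" "\<lambda>_. unit_vec s" "{s}"] \<beta> height_unit[OF assms(2)] by simp
  then have "\<beta> s * \<omega> s = (- 1) * \<omega> s" using assms(3) by (simp add: \<beta>_def)
  then have "\<beta> s = - 1" using assms(4) by (metis less_irrefl mult_right_cancel)
  then show ?thesis using \<beta> by (simp add: \<beta>_def)
qed

subsection \<open>Invariants of conjugacy classes\<close>

definition trace :: "'i list \<Rightarrow> int" where
  "trace u = (\<Sum>s\<in>I. act u (unit_vec s) s)"

lemma trace_append_comm:
  assumes "u \<in> lists I" "v \<in> lists I"
  shows "trace (u @ v) = trace (v @ u)"
proof -
  have mat: "act (u @ v) (unit_vec s) s = (\<Sum>j\<in>I. act v (unit_vec s) j * act u (unit_vec j) s :: int)"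
    if "s \<in> I" "v \<in> lists I" for u v s
  proof -
    have "act v (unit_vec s) k = (0 :: int)" if "k \<notin> I" for k
      using root_supported[OF \<open>v \<in> lists I\<close> \<open>s \<in> I\<close> that] .
    then show ?thesis by (simp add: act_decomp[of I "act v (unit_vec s)" u])
  qed
  show ?thesis
    unfolding trace_def using assms
    by (simp add: mat del: act_append) (subst sum.swap, simp add: mult.commute)
qed

lemma trace_cong: "u \<sim> v \<Longrightarrow> trace u = trace v"
  by (simp add: trace_def act_cong)

lemma trace_conj:
  assumes "u \<in> lists I" "v \<in> lists I" "conj_class W (cls u) = conj_class W (cls v)"
  shows "trace u = trace v"
proof -
  obtain g where g: "g \<in> lists I" "v \<sim> g @ u @ rev g" using conj_class_cls_eqD assms by blast
  have "trace v = trace ((u @ rev g) @ g)"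
    using trace_cong[OF g(2)] trace_append_comm[of g "u @ rev g"] g(1) assms(1) rev_lists by simp
  also have "\<dots> = trace u"
    using eqv_lists_append_cong(2)[OF rev_cancel[OF g(1)] assms(1)] trace_cong by fastforce
  finally show ?thesis ..
qed

text \<open>The inner product of \<open>v\<close> with the simple root \<open>i\<close>, scaled so
  that roots have square length 2. It is integral, which gives the parity below a meaning.\<close>

definition pairing :: "'i \<Rightarrow> ('i \<Rightarrow> int) \<Rightarrow> int" where
  "pairing i v = 2 * v i - nbr_sum i v"

definition form :: "('i \<Rightarrow> int) \<Rightarrow> ('i \<Rightarrow> int) \<Rightarrow> int" where
  "form v w = (\<Sum>i\<in>I. v i * pairing i w)"

lemma form_sym: "form v w = form w v"
proof -
  have "(\<Sum>i\<in>I. v i * nbr_sum i w) = (\<Sum>i\<in>I. \<Sum>j\<in>I. if m i j = 3 then v i * w j else 0)" for v w :: "'i \<Rightarrow> int"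
    unfolding nbr_sum_def sum_distrib_left by (intro sum.cong) simp_all
  moreover have "(\<Sum>i\<in>I. \<Sum>j\<in>I. if m i j = 3 then v i * w j else 0)
      = (\<Sum>i\<in>I. \<Sum>j\<in>I. if m i j = 3 then w i * v j else 0)"
    by (subst sum.swap) (simp add: sym mult.commute cong: if_cong)
  ultimately show ?thesis
    by (simp add: form_def pairing_def right_diff_distrib sum_subtractf mult.left_commute mult.commute)
qed

lemma refl_eq_upd: "refl i v = v(i := v i - pairing i v)"
  by (simp add: refl_def pairing_def)

lemma form_refl_left:
  assumes "s \<in> I"
  shows "form (refl s v) w = form v w - pairing s v * pairing s w"
proof -
  have "(\<Sum>i\<in>I - {s}. refl s v i * pairing i w) = (\<Sum>i\<in>I - {s}. v i * pairing i w)"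
    by (rule sum.cong) (simp_all add: refl_def)
  then show ?thesis
    unfolding form_def using assms
    by (simp add: sum.remove[of I s] refl_eq_upd left_diff_distrib)
qed

lemma form_refl:
  assumes "s \<in> I"
  shows "form (refl s v) (refl s w) = form v w"
proof -
  have "pairing s (refl s w) = - pairing s w"
    using assms by (simp add: pairing_def refl_def nbr_sum_upd)
  then show ?thesis
    using form_refl_left[OF assms, of v "refl s w"] form_refl_left[OF assms, of w v]
      form_sym[of v "refl s w"] form_sym[of v w] by (simp add: mult.commute)
qed

lemma form_act: "u \<in> lists I \<Longrightarrow> form (act u v) (act u w) = form v w"
  by (induction u) (simp_all add: form_refl)

definition even_form :: "'i list \<Rightarrow> bool" where
  "even_form u \<longleftrightarrow> (\<forall>v. even (form (act u v) v))"

text \<open>Invariance of the form gives \<open>(g u g^-1 x, x) = (u y, y)\<close> with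
  \<open>y = g^-1 x\<close>.\<close>

lemma even_form_conj:
  assumes "u \<in> lists I" "v \<in> lists I" "conj_class W (cls u) = conj_class W (cls v)" "even_form u"
  shows "even_form v"
  unfolding even_form_def
proof
  fix x
  obtain g where g: "g \<in> lists I" "v \<sim> g @ u @ rev g" using conj_class_cls_eqD assms by blast
  have "form (act v x) x = form (act g (act u (act (rev g) x))) (act g (act (rev g) x))"
    using act_cong[OF g(2), of x] by (simp add: act_rev_act(2)[OF g(1)])
  then show "even (form (act v x) x)"
    using assms(4) by (simp add: form_act[OF g(1)] even_form_def)
qed

text \<open>Stated as a function of the class, so that ten distinct values prove ten classes
  distinct at once. It is well defined by \<open>trace_conj\<close> and
  \<open>even_form_conj\<close>.\<close>

definition class_invariant :: "'i list set set \<Rightarrow> int \<times> bool" where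
  "class_invariant C = (THE p. \<exists>u\<in>lists I. C = conj_class W (cls u) \<and> p = (trace u, even_form u))"

lemma class_invariant_eq:
  assumes "u \<in> lists I"
  shows "class_invariant (conj_class W (cls u)) = (trace u, even_form u)"
  unfolding class_invariant_def
  by (rule the_equality) (use assms trace_conj even_form_conj in blast)+

end

section \<open>The Weyl group of type E7\<close>

interpretation E7: simply_laced E7_nodes E7_matrix
  by standard (auto simp: E7_nodes_def E7_matrix_def insert_commute)

lemma E7_nodes_eq: "E7_nodes = {1, 2, 3, 4, 5, 6, 7}"
  by (auto simp: E7_nodes_def)

text \<open>A functional on the root lattice is stored by its values at the seven simple roots;
  \<open>fire t\<close> is the right action of the simple reflection \<open>t\<close> on functionals.\<close>

type_synonym vec = "int \<times> int \<times> int \<times> int \<times> int \<times> int \<times> int"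

definition coord :: "vec \<Rightarrow> nat \<Rightarrow> int" where
  "coord p s = (case p of (a, b, c, d, e, f, g) \<Rightarrow>
     if s = 1 then a else if s = 2 then b else if s = 3 then c else if s = 4 then d
     else if s = 5 then e else if s = 6 then f else g)"

definition fire :: "nat \<Rightarrow> vec \<Rightarrow> vec" where
  "fire t p = (case p of (a, b, c, d, e, f, g) \<Rightarrow>
     if t = 1 then (- a, b, c + a, d, e, f, g)
     else if t = 2 then (a, - b, c, d + b, e, f, g)
     else if t = 3 then (a + c, b, - c, d + c, e, f, g)
     else if t = 4 then (a, b + d, c + d, - d, e + d, f, g)
     else if t = 5 then (a, b, c, d + e, - e, f + e, g)
     else if t = 6 then (a, b, c, d, e + f, - f, g + f)
     else (a, b, c, d, e, f + g, - g))"

text \<open>The values are distinct, so that an element which permutes the negatives of some simple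
  roots nontrivially is distinguished from \<open>-1\<close>.\<close>

definition weights :: vec where
  "weights = (1, 2, 3, 4, 5, 6, 7)"

text \<open>This is \<open>weights\<close> composed with the action of \<open>u\<close>. A letter
  appended on the right acts first on vectors, hence last on the functional; therefore
  \<open>fold\<close>, although \<open>act\<close> is a \<open>foldr\<close>.\<close>

definition moved :: "nat list \<Rightarrow> vec" where
  "moved u = fold fire u weights"

lemma coord_weights: "s \<in> E7_nodes \<Longrightarrow> coord weights s = int s"
  by (auto simp: E7_nodes_eq coord_def weights_def)

lemma coord_fire:
  assumes "s \<in> E7_nodes" "t \<in> E7_nodes"
  shows "coord (fire t p) s = (if s = t then - coord p t
    else if E7_matrix s t = 3 then coord p s + coord p t else coord p s)"
proof -
  obtain a b c d e f g where p: "p = (a, b, c, d, e, f, g)" by (metis prod_cases7)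
  show ?thesis using assms unfolding E7_nodes_eq p
    by (elim insertE emptyE)
      (simp_all add: coord_def fire_def E7_matrix_def E7_edges_def doubleton_eq_iff)
qed

lemma coord_moved:
  assumes "u \<in> lists E7_nodes" "s \<in> E7_nodes"
  shows "coord (moved u) s = E7.height int (E7.act u (unit_vec s))"
  using assms
proof (induction u arbitrary: s rule: rev_induct)
  case Nil
  then show ?case by (simp add: moved_def coord_weights E7.height_unit)
next
  case (snoc t u)
  then have "t \<in> E7_nodes" "u \<in> lists E7_nodes" by auto
  then show ?case using snoc.IH snoc.prems(2)
    by (simp add: moved_def coord_fire E7.height_snoc del: E7.act_append)
qed

lemma node_pos: "k \<in> E7_nodes \<Longrightarrow> 0 < int k"
  by (simp add: E7_nodes_def)

lemma eqv_if_moved_eq: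
  assumes "u \<in> lists E7_nodes" "v \<in> lists E7_nodes" "moved u = moved v"
  shows "cox_eq E7_nodes E7_matrix u v"
  using assms coord_moved by (intro E7.eqv_if_height_eq[of _ _ int] node_pos) metis+

text \<open>A greedy numbers game: a positive value at \<open>s\<close> means that \<open>s\<close>
  still lengthens the word built so far. When no positive value is left on \<open>J\<close>, the
  word represents the longest element; that this state is reached is verified by evaluation.\<close>

primrec sort_word :: "nat \<Rightarrow> nat list \<Rightarrow> vec \<Rightarrow> nat list" where
  "sort_word 0 J p = []"
| "sort_word (Suc n) J p =
    (case find (\<lambda>s. 0 < coord p s) J of None \<Rightarrow> [] | Some s \<Rightarrow> s # sort_word n J (fire s p))"

text \<open>The number of positive roots is 63, so the fuel suffices to make the functional negative
  on \<open>J\<close>.\<close>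

definition longest_word :: "nat list \<Rightarrow> nat list" where
  "longest_word J = sort_word 63 J weights"

lemma longest_word_lists: "longest_word J \<in> lists (set J)"
proof -
  have "sort_word n J p \<in> lists (set J)" for n p
    by (induction n arbitrary: p) (auto split: option.split simp: find_Some_iff)
  then show ?thesis by (simp add: longest_word_def)
qed

text \<open>An entry \<open>(J, K, g)\<close> asserts that \<open>g\<close> conjugates \<open>w\<^sub>J\<close> to \<open>w\<^sub>K\<close>; the sets \<open>J\<close> are those for
  which \<open>w\<^sub>J\<close> acts as \<open>-1\<close> on the roots of \<open>J\<close>.\<close>

definition conj_table :: "(nat list \<times> nat list \<times> nat list) list" where
  "conj_table =
  [([], [], []),
   ([1], [1], []),
   ([2], [1], [3, 1, 4, 2, 3, 4]),
   ([3], [1], [3, 1]),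
   ([4], [1], [3, 1, 4, 3]),
   ([5], [1], [3, 1, 4, 3, 5, 4]),
   ([6], [1], [3, 1, 4, 3, 5, 4, 6, 5]),
   ([7], [1], [3, 1, 4, 3, 5, 4, 6, 5, 7, 6]),
   ([1, 2], [1, 4], [2, 4]),
   ([1, 4], [1, 4], []),
   ([1, 5], [1, 4], [5, 4]),
   ([1, 6], [1, 4], [5, 4, 6, 5]),
   ([1, 7], [1, 4], [5, 4, 6, 5, 7, 6]),
   ([2, 3], [1, 4], [2, 4, 3, 1]),
   ([2, 5], [1, 4], [5, 4, 3, 1, 6, 5, 4, 2, 3, 4, 5, 6]),
   ([2, 6], [1, 4], [5, 4, 3, 1, 6, 5, 4, 2, 3, 4]),
   ([2, 7], [1, 4], [5, 4, 3, 1, 6, 5, 4, 2, 3, 4, 7, 6]),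
   ([3, 5], [1, 4], [5, 4, 3, 1]),
   ([3, 6], [1, 4], [5, 4, 3, 1, 6, 5]),
   ([3, 7], [1, 4], [5, 4, 3, 1, 6, 5, 7, 6]),
   ([4, 6], [1, 4], [5, 4, 3, 1, 6, 5, 4, 3]),
   ([4, 7], [1, 4], [5, 4, 3, 1, 6, 5, 4, 3, 7, 6]),
   ([5, 7], [1, 4], [5, 4, 3, 1, 6, 5, 4, 3, 7, 6, 5, 4]),
   ([1, 2, 5], [1, 4, 6], [2, 4, 5, 6]),
   ([1, 2, 6], [1, 4, 6], [2, 4]),
   ([1, 2, 7], [1, 4, 6], [2, 4, 7, 6]),
   ([1, 4, 6], [1, 4, 6], []),
   ([1, 4, 7], [1, 4, 6], [7, 6]),
   ([1, 5, 7], [1, 4, 6], [7, 6, 5, 4]),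
   ([2, 3, 5], [1, 4, 6], [2, 4, 3, 1, 5, 6]),
   ([2, 3, 6], [1, 4, 6], [2, 4, 3, 1]),
   ([2, 3, 7], [1, 4, 6], [2, 4, 3, 1, 7, 6]),
   ([2, 5, 7], [2, 5, 7], []),
   ([3, 5, 7], [1, 4, 6], [7, 6, 5, 4, 3, 1]),
   ([1, 2, 5, 7], [1, 2, 5, 7], []),
   ([2, 3, 4, 5], [2, 3, 4, 5], []),
   ([2, 3, 5, 7], [1, 2, 5, 7], [3, 1]),
   ([2, 3, 4, 5, 7], [2, 3, 4, 5, 7], []),
   ([2, 3, 4, 5, 6, 7], [2, 3, 4, 5, 6, 7], []),
   ([1, 2, 3, 4, 5, 6, 7], [1, 2, 3, 4, 5, 6, 7], [])]"

text \<open>An entry \<open>(J, K, g)\<close> asserts that \<open>g\<close> conjugates \<open>w\<^sub>o w\<^sub>J\<close> to \<open>w\<^sub>K\<close>.\<close>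

definition opposite_table :: "(nat list \<times> nat list \<times> nat list) list" where
  "opposite_table =
  [([], [1, 2, 3, 4, 5, 6, 7], []),
   ([1], [2, 3, 4, 5, 6, 7], [1, 3, 4, 2, 5, 4, 3, 6, 5, 4, 2, 7, 6, 5, 4, 3]),
   ([1, 4], [2, 3, 4, 5, 7], [1, 3, 4, 2, 6, 5, 4, 2, 3, 1, 4, 3, 5, 4, 2, 6, 5, 4, 7, 6, 5, 4, 2, 3]),
   ([1, 4, 6], [1, 2, 5, 7], [3, 4, 2, 3, 1, 4, 5, 4, 6, 5, 4, 2, 3, 1, 4, 3, 5, 4, 2, 6, 5, 4, 7, 6, 5, 4, 2, 3]),
   ([2, 5, 7], [2, 3, 4, 5], [1, 3, 4, 2, 6, 5, 4, 2, 3, 1, 4, 3, 7, 6, 5, 4, 2, 3, 1, 4, 3, 5, 4, 6])]"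

section \<open>Evaluation of the tables and of the longest words\<close>

definition all_nodes :: "nat list" where
  "all_nodes = [1, 2, 3, 4, 5, 6, 7]"

definition wo_word :: "nat list" where
  "wo_word = longest_word all_nodes"

text \<open>For \<open>J\<close> outside the table, one value other than \<open>- int s\<close>
  proves that the longest element does not negate the simple root \<open>s\<close>, so
  \<open>J\<close> is not the descent set of a minimal involution.\<close>

lemma longest_word_check:
  "list_all (\<lambda>J. let p = moved (longest_word J) in
     list_all (\<lambda>s. coord p s < 0) J \<and>
     (J \<in> set (map fst conj_table) \<or> list_ex (\<lambda>s. coord p s \<noteq> - int s) J)) (subseqs all_nodes)"
  by code_simp

lemma conj_table_check:
  "list_all (\<lambda>(J, K, g). J \<in> set (subseqs all_nodes) \<and> K \<in> set (map fst conj_table) \<and>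
     list_all (\<lambda>s. s \<in> set all_nodes) g \<and>
     moved (longest_word J @ longest_word J) = weights \<and>
     moved (g @ longest_word J) = moved (longest_word K @ g)) conj_table"
  by code_simp

lemma opposite_table_check:
  "list_all (\<lambda>(J, K, g). J \<in> set (map fst conj_table) \<and> K \<in> set (map fst conj_table) \<and>
     list_all (\<lambda>s. s \<in> set all_nodes) g \<and>
     moved (g @ wo_word @ longest_word J) = moved (longest_word K @ g)) opposite_table"
  by code_simp

text \<open>The value \<open>- int s\<close> alone does not identify a root: simple root 4 and the
  sum of simple roots 1 and 3 both have height 4. Commutation with each generator removes this
  ambiguity.\<close>

lemma wo_check:
  "all_nodes \<in> set (map fst conj_table) \<and>
   list_all (\<lambda>s. moved (wo_word @ [s]) = moved (s # wo_word) \<and> coord (moved wo_word) s = - int s) all_nodes"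
  by code_simp

subsection \<open>The classes of involutions\<close>

lemma set_all_nodes: "set all_nodes = E7_nodes"
  by (simp add: all_nodes_def E7_nodes_eq)

lemma longest_word_nodes:
  assumes "J \<in> set (subseqs all_nodes)"
  shows "set J \<subseteq> E7_nodes" "longest_word J \<in> lists E7_nodes"
proof -
  have "set J \<in> Pow (set all_nodes)" using assms subseqs_powset by (metis imageI)
  then show "set J \<subseteq> E7_nodes" by (simp add: set_all_nodes)
  then show "longest_word J \<in> lists E7_nodes" using longest_word_lists[of J] lists_mono by blast
qed

lemma longest_word_nonpos:
  assumes "J \<in> set (subseqs all_nodes)" "s \<in> set J"
  shows "nonneg (\<lambda>k. - E7.act (longest_word J) (unit_vec s) k)"
proof -
  have s: "s \<in> E7_nodes" and w: "longest_word J \<in> lists E7_nodes"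
    using longest_word_nodes[OF assms(1)] assms(2) by auto
  have "coord (moved (longest_word J)) s < 0"
    using longest_word_check assms by (auto simp: list_all_iff Let_def)
  then show ?thesis using E7.root_sign_height(2)[OF w s node_pos] coord_moved[OF w s] by simp
qed

lemma w_E7_eq:
  assumes "J \<in> set (subseqs all_nodes)"
  shows "w_E7 (set J) = E7.cls (longest_word J)"
  unfolding w_E7_def E7.parabolic_eq[OF longest_word_nodes(1)[OF assms]]
  using longest_word_nodes(1)[OF assms] longest_word_lists longest_word_nonpos[OF assms]
  by (rule E7.longest_element_eq)

lemma cl_E7_eq:
  "J \<in> set (subseqs all_nodes) \<Longrightarrow> cl_E7 (set J) = conj_class E7.W (E7.cls (longest_word J))"
  by (simp add: cl_E7_def w_E7_eq W_E7_def)

lemma table_subseqs: "J \<in> set (map fst conj_table) \<Longrightarrow> J \<in> set (subseqs all_nodes)"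
  using conj_table_check by (auto simp: list_all_iff)

lemma table_involution:
  assumes "J \<in> set (map fst conj_table)"
  shows "E7.cls (longest_word J) \<in> involutions E7.W"
proof -
  have w: "longest_word J \<in> lists E7_nodes" by (rule longest_word_nodes(2)[OF table_subseqs[OF assms]])
  have "moved (longest_word J @ longest_word J) = moved []"
    using conj_table_check assms by (auto simp: list_all_iff moved_def)
  then have "cox_eq E7_nodes E7_matrix (longest_word J @ longest_word J) []"
    using w by (intro eqv_if_moved_eq) auto
  then show ?thesis using w by (auto simp: E7.involutions_W)
qed

lemma table_conj:
  assumes "(J, K, g) \<in> set conj_table"
  shows "cl_E7 (set J) = cl_E7 (set K)"
proof -
  have J: "J \<in> set (subseqs all_nodes)" and "K \<in> set (map fst conj_table)"
    and "set g \<subseteq> set all_nodes"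
    and eq: "moved (g @ longest_word J) = moved (longest_word K @ g)"
    using conj_table_check assms by (auto simp: list_all_iff)
  then have K: "K \<in> set (subseqs all_nodes)" and g: "g \<in> lists E7_nodes"
    using table_subseqs by (auto simp: set_all_nodes)
  note w = longest_word_nodes(2)[OF J] longest_word_nodes(2)[OF K]
  have "cox_eq E7_nodes E7_matrix (g @ longest_word J) (longest_word K @ g)"
    using w g eq by (intro eqv_if_moved_eq) auto
  then show ?thesis using E7.conj_class_cls_eqI[OF w g] cl_E7_eq J K by simp
qed

lemma involution_class_in_table:
  assumes "x \<in> involutions W_E7"
  shows "\<exists>J\<in>set (map fst conj_table). conj_class W_E7 x = cl_E7 (set J)"
proof -
  obtain u where u: "x = E7.cls u" "u \<in> lists E7_nodes" "cox_eq E7_nodes E7_matrix (u @ u) []"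
    using assms by (auto simp: W_E7_def E7.involutions_W)
  then obtain v where v: "v \<in> lists E7_nodes" "cox_eq E7_nodes E7_matrix (v @ v) []"
    "conj_class E7.W (E7.cls v) = conj_class E7.W (E7.cls u)"
    and min: "\<And>s. s \<in> E7_nodes \<Longrightarrow> nonneg (\<lambda>k. - E7.act v (unit_vec s) k)
      \<Longrightarrow> E7.act v (unit_vec s) = (\<lambda>k. - unit_vec s k :: int)"
    using E7.involution_conj_minimal[OF u(2,3)] by blast
  \<comment> \<open>By minimality these negated simple roots are exactly the descents of
    \<open>v\<close>.\<close>
  define D where "D = {s \<in> E7_nodes. E7.act v (unit_vec s) = (\<lambda>k. - unit_vec s k :: int)}"
  have "D \<in> set ` set (subseqs all_nodes)"
    unfolding subseqs_powset set_all_nodes by (auto simp: D_def)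
  then obtain J where J: "J \<in> set (subseqs all_nodes)" "set J = D" by auto
  note w = longest_word_nodes[OF J(1)]
  have eq: "cox_eq E7_nodes E7_matrix v (longest_word J)"
    by (rule E7.minimal_involution_eqv_longest[OF v(1,2) w(1) _ _ longest_word_lists])
      (use min longest_word_nonpos[OF J(1)] J(2) in \<open>auto simp: D_def\<close>)
  have "coord (moved (longest_word J)) s = - int s" if "s \<in> set J" for s
  proof -
    have s: "s \<in> E7_nodes" using that w by auto
    have "E7.act (longest_word J) (unit_vec s) = (\<lambda>k. - unit_vec s k :: int)"
      using that J(2) E7.act_cong[OF eq, of "unit_vec s :: nat \<Rightarrow> int"] by (simp add: D_def)
    then show ?thesis
      using coord_moved[OF w(2) s] by (simp add: E7.height_minus E7.height_unit[OF s])
  qed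
  then have "J \<in> set (map fst conj_table)"
    using longest_word_check J(1) by (fastforce simp: list_all_iff list_ex_iff Let_def)
  moreover have "conj_class W_E7 x = cl_E7 (set J)"
    using v(3) u(1) eq unfolding cl_E7_eq[OF J(1)] W_E7_def E7.cls_eq_iff[OF v(1), symmetric] by simp
  ultimately show ?thesis by blast
qed

subsection \<open>The longest element\<close>

lemma all_nodes_in_table: "all_nodes \<in> set (map fst conj_table)"
  using wo_check by simp

lemma wo_word_lists: "wo_word \<in> lists E7_nodes"
  unfolding wo_word_def by (rule longest_word_nodes(2)[OF table_subseqs[OF all_nodes_in_table]])

lemma wo_E7_eq: "wo_E7 = E7.cls wo_word"
  using w_E7_eq[OF table_subseqs[OF all_nodes_in_table]]
  by (simp add: wo_E7_def w_E7_def wo_word_def set_all_nodes W_E7_def E7.carrier_W E7.parabolic_eq)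

lemma act_wo_unit:
  assumes "s \<in> E7_nodes"
  shows "E7.act wo_word (unit_vec s) = (\<lambda>k. - unit_vec s k :: int)"
proof (rule E7.act_unit_minus_if_commutes[where \<omega> = int])
  have "moved (wo_word @ [s]) = moved (s # wo_word)" and c: "coord (moved wo_word) s = - int s"
    using wo_check assms by (auto simp: list_all_iff set_all_nodes)
  then show "cox_eq E7_nodes E7_matrix (wo_word @ [s]) (s # wo_word)"
    using assms wo_word_lists by (intro eqv_if_moved_eq) auto
  show "E7.height int (E7.act wo_word (unit_vec s)) = - int s"
    using coord_moved[OF wo_word_lists assms] c by simp
qed (use assms node_pos in auto)

lemma act_wo:
  assumes "\<And>k. k \<notin> E7_nodes \<Longrightarrow> v k = 0"
  shows "E7.act wo_word v = (\<lambda>k. - v k :: int)"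
proof
  fix k show "E7.act wo_word v k = - v k"
    using E7.act_eq_minus[OF act_wo_unit, of k v] E7.act_inside[OF wo_word_lists, of k v] assms
    by (cases "k \<in> E7_nodes") simp_all
qed

lemma act_wo_root:
  assumes "u \<in> lists E7_nodes" "s \<in> E7_nodes"
  shows "E7.act wo_word (E7.act u (unit_vec s)) = (\<lambda>k. - E7.act u (unit_vec s) k :: int)"
  by (rule act_wo) (rule E7.root_supported[OF assms])

lemma wo_square: "cox_eq E7_nodes E7_matrix (wo_word @ wo_word) []"
  using wo_word_lists by (subst E7.eqv_iff_act) (simp_all add: act_wo_unit E7.act_minus)

lemma wo_commutes:
  assumes "u \<in> lists E7_nodes"
  shows "cox_eq E7_nodes E7_matrix (wo_word @ u) (u @ wo_word)"
proof (subst E7.eqv_iff_act)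
  show "\<forall>s\<in>E7_nodes. E7.act (wo_word @ u) (unit_vec s) = (E7.act (u @ wo_word) (unit_vec s) :: nat \<Rightarrow> int)"
    by (simp add: act_wo_root[OF assms] act_wo_unit E7.act_minus)
qed (use assms wo_word_lists in auto)

lemma wo_central: "x \<in> carrier W_E7 \<Longrightarrow> wo_E7 \<otimes>\<^bsub>W_E7\<^esub> x = x \<otimes>\<^bsub>W_E7\<^esub> wo_E7"
proof -
  assume "x \<in> carrier W_E7"
  then obtain u where u: "u \<in> lists E7_nodes" "x = E7.cls u"
    unfolding W_E7_def E7.carrier_W by blast
  have "wo_word @ u \<in> lists E7_nodes" using u wo_word_lists by simp
  then show ?thesis
    using u wo_word_lists E7.cls_eq_iff wo_commutes[OF u(1)] by (simp add: W_E7_def wo_E7_eq E7.mult_W)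
qed

lemma trace_wo:
  assumes "u \<in> lists E7_nodes"
  shows "E7.trace (wo_word @ u) = - E7.trace u"
  by (simp add: act_wo_root[OF assms] E7.trace_def sum_negf)

lemma even_form_wo:
  assumes "u \<in> lists E7_nodes"
  shows "E7.even_form (wo_word @ u) = E7.even_form u"
proof -
  have "E7.form (E7.act wo_word v) x = - E7.form v x" for v x
    unfolding E7.form_def sum_negf[symmetric]
    by (rule sum.cong) (simp_all add: E7.act_eq_minus[OF act_wo_unit])
  then show ?thesis by (simp add: E7.even_form_def)
qed

lemma opposite_conj:
  assumes "(J, K, g) \<in> set opposite_table"
  shows "cl_E7 (set K) = conj_class W_E7 (E7.cls (wo_word @ longest_word J))"
proof -
  have "J \<in> set (map fst conj_table)" "K \<in> set (map fst conj_table)" "set g \<subseteq> set all_nodes"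
    and eq: "moved (g @ wo_word @ longest_word J) = moved (longest_word K @ g)"
    using opposite_table_check assms by (auto simp: list_all_iff)
  then have J: "J \<in> set (subseqs all_nodes)" and K: "K \<in> set (subseqs all_nodes)"
    and g: "g \<in> lists E7_nodes"
    using table_subseqs by (auto simp: set_all_nodes)
  have w: "wo_word @ longest_word J \<in> lists E7_nodes" "longest_word K \<in> lists E7_nodes"
    using wo_word_lists longest_word_nodes(2) J K by auto
  have "cox_eq E7_nodes E7_matrix (g @ wo_word @ longest_word J) (longest_word K @ g)"
    using w g eq by (intro eqv_if_moved_eq) auto
  then show ?thesis using E7.conj_class_cls_eqI[OF w g] cl_E7_eq[OF K] by (simp add: W_E7_def)
qed

lemma opposite_interchanges:
  assumes "(J, K, g) \<in> set opposite_table"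
  shows "interchanges_classes W_E7 wo_E7 (cl_E7 (set J)) (cl_E7 (set K))"
proof -
  have J: "J \<in> set (subseqs all_nodes)"
    using opposite_table_check assms by (intro table_subseqs) (auto simp: list_all_iff)
  note w = longest_word_nodes(2)[OF J]
  show ?thesis
    unfolding cl_E7_eq[OF J] W_E7_def[symmetric]
  proof (rule interchanges_conj_classes[OF group_W_E7])
    show "wo_E7 \<otimes>\<^bsub>W_E7\<^esub> wo_E7 = \<one>\<^bsub>W_E7\<^esub>"
      using wo_square wo_word_lists E7.cls_eq_iff[of "wo_word @ wo_word" "[]"]
      by (simp add: wo_E7_eq W_E7_def E7.mult_W E7.one_W)
    show "conj_class W_E7 (wo_E7 \<otimes>\<^bsub>W_E7\<^esub> E7.cls (longest_word J)) = cl_E7 (set K)"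
      using opposite_conj[OF assms] wo_word_lists w by (simp add: wo_E7_eq W_E7_def E7.mult_W)
  qed (use wo_central wo_word_lists w in \<open>auto simp: wo_E7_eq W_E7_def E7.carrier_W\<close>)
qed

subsection \<open>Distinguishing the classes\<close>

lemma E7_nbr_sum:
  "E7.nbr_sum 1 v = v 3" "E7.nbr_sum (Suc 0) v = v 3" "E7.nbr_sum 2 v = v 4"
  "E7.nbr_sum 3 v = v 1 + v 4" "E7.nbr_sum 4 v = v 2 + v 3 + v 5"
  "E7.nbr_sum 5 v = v 4 + v 6" "E7.nbr_sum 6 v = v 5 + v 7" "E7.nbr_sum 7 v = v 6"
  unfolding E7.nbr_sum_def unfolding E7_nodes_eq
  by (simp_all add: E7_matrix_def E7_edges_def doubleton_eq_iff)

lemma sum_E7_nodes: "(\<Sum>s\<in>E7_nodes. f s) = f 1 + f 2 + f 3 + f 4 + f 5 + f 6 + (f 7 :: int)"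
  by (simp add: E7_nodes_eq)

text \<open>A product of \<open>k\<close> commuting simple reflections has a -1 eigenspace of
  dimension \<open>k\<close>, so its trace is \<open>7 - 2 * k\<close>.\<close>

lemma traces:
  "E7.trace [] = 7" "E7.trace [1] = 5" "E7.trace [1, 4] = 3"
  "E7.trace [1, 4, 6] = 1" "E7.trace [2, 5, 7] = 1"
  unfolding E7.trace_def sum_E7_nodes by (simp_all add: E7.refl_def E7_nbr_sum unit_vec_def)

text \<open>For orthogonal roots \<open>a\<close>, \<open>b\<close>, \<open>c\<close> the value
  \<open>(u v, v) = (v, v) - (a, v)^2 - (b, v)^2 - (c, v)^2\<close> has the parity of
  \<open>(a + b + c, v)\<close>, because \<open>(v, v)\<close> is even. For nodes 2, 5, 7 the sum
  pairs evenly with every simple root: nodes 4 and 6 have two neighbours among them, nodes 1 and 3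
  none.\<close>

lemma even_form_257: "E7.even_form [2, 5, 7]"
  by (auto simp: E7.even_form_def E7.form_def sum_E7_nodes E7.pairing_def E7.refl_def E7_nbr_sum)

lemma not_even_form_146: "\<not> E7.even_form [1, 4, 6]"
proof -
  \<comment> \<open>Node 7 has just one neighbour, 6, among 1, 4, 6, so it pairs oddly with the sum
    of these roots.\<close>
  have "odd (E7.form (E7.act [1, 4, 6] (unit_vec 7)) (unit_vec 7))"
    by (simp add: E7.form_def sum_E7_nodes E7.pairing_def E7.refl_def E7_nbr_sum unit_vec_def)
  then show ?thesis by (auto simp: E7.even_form_def)
qed

lemma class_invariant_cl:
  assumes "J \<in> set (subseqs all_nodes)" "longest_word J = w"
  shows "E7.class_invariant (cl_E7 (set J)) = (E7.trace w, E7.even_form w)"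
  using cl_E7_eq[OF assms(1)] E7.class_invariant_eq longest_word_nodes(2)[OF assms(1)] assms(2) by simp

text \<open>Passing through \<open>wo_word\<close> gives the invariants of the class of
  \<open>K\<close> from the short word of \<open>J\<close>, without evaluating the long word of
  \<open>K\<close>.\<close>

lemma class_invariant_opposite:
  assumes "(J, K, g) \<in> set opposite_table" "longest_word J = w"
  shows "E7.class_invariant (cl_E7 (set K)) = (- E7.trace w, E7.even_form w)"
proof -
  have J: "J \<in> set (subseqs all_nodes)"
    using opposite_table_check assms(1) by (intro table_subseqs) (auto simp: list_all_iff)
  have w: "w \<in> lists E7_nodes" using longest_word_nodes(2)[OF J] assms(2) by simp
  then have "wo_word @ w \<in> lists E7_nodes" using wo_word_lists by simp
  from E7.class_invariant_eq[OF this] show ?thesis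
    using opposite_conj[OF assms(1)] w by (simp add: W_E7_def assms(2) trace_wo even_form_wo)
qed

lemma short_longest_words:
  "longest_word [] = []" "longest_word [1] = [1]" "longest_word [1, 4] = [1, 4]"
  "longest_word [1, 4, 6] = [1, 4, 6]" "longest_word [2, 5, 7] = [2, 5, 7]"
  by code_simp+

definition class_representatives :: "nat list list" where
  "class_representatives = [[], [1, 2, 3, 4, 5, 6, 7], [1], [2, 3, 4, 5, 6, 7], [1, 4],
    [2, 3, 4, 5, 7], [1, 4, 6], [1, 2, 5, 7], [2, 5, 7], [2, 3, 4, 5]]"

lemma representatives_check:
  "list_all (\<lambda>K. K \<in> set (map fst conj_table)) class_representatives \<and>
   list_all (\<lambda>(J, K, g). K \<in> set class_representatives) conj_table"
  by code_simp

lemma conj_class_involutions: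
  "conj_class W_E7 ` involutions W_E7 = (\<lambda>K. cl_E7 (set K)) ` set class_representatives"
proof
  show "conj_class W_E7 ` involutions W_E7 \<subseteq> (\<lambda>K. cl_E7 (set K)) ` set class_representatives"
  proof
    fix C assume "C \<in> conj_class W_E7 ` involutions W_E7"
    then obtain J where "J \<in> set (map fst conj_table)" and C: "C = cl_E7 (set J)"
      using involution_class_in_table by blast
    then obtain K g where t: "(J, K, g) \<in> set conj_table" by auto
    then have "K \<in> set class_representatives"
      using representatives_check by (auto simp: list_all_iff)
    then show "C \<in> (\<lambda>K. cl_E7 (set K)) ` set class_representatives"
      using table_conj[OF t] C by blast
  qed
  show "(\<lambda>K. cl_E7 (set K)) ` set class_representatives \<subseteq> conj_class W_E7 ` involutions W_E7"
  proof
    fix C assume "C \<in> (\<lambda>K. cl_E7 (set K)) ` set class_representatives"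
    then obtain K where "K \<in> set class_representatives" "C = cl_E7 (set K)" by blast
    moreover from this have "K \<in> set (map fst conj_table)"
      using representatives_check by (auto simp: list_all_iff)
    ultimately have "K \<in> set (map fst conj_table)" "C = cl_E7 (set K)" by blast+
    then show "C \<in> conj_class W_E7 ` involutions W_E7"
      using table_involution cl_E7_eq[OF table_subseqs] by (simp add: W_E7_def)
  qed
qed

lemma opposite_table_entries:
  obtains g1 g2 g3 g4 g5 where
    "([], [1, 2, 3, 4, 5, 6, 7], g1) \<in> set opposite_table"
    "([1], [2, 3, 4, 5, 6, 7], g2) \<in> set opposite_table"
    "([1, 4], [2, 3, 4, 5, 7], g3) \<in> set opposite_table"
    "([1, 4, 6], [1, 2, 5, 7], g4) \<in> set opposite_table"
    "([2, 5, 7], [2, 3, 4, 5], g5) \<in> set opposite_table"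
  by (simp add: opposite_table_def)

lemma conj_table_entries:
  obtains g1 g2 g3 g4 where
    "([3], [1], g1) \<in> set conj_table" "([1, 5], [1, 4], g2) \<in> set conj_table"
    "([1, 2, 7], [1, 4, 6], g3) \<in> set conj_table" "([2, 3, 5, 7], [1, 2, 5, 7], g4) \<in> set conj_table"
  by (simp add: conj_table_def)

lemma distinct_classes: "distinct (map (\<lambda>K. cl_E7 (set K)) class_representatives)"
proof -
  obtain g1 g2 g3 g4 g5 where
    t: "([], [1, 2, 3, 4, 5, 6, 7], g1) \<in> set opposite_table"
    "([1], [2, 3, 4, 5, 6, 7], g2) \<in> set opposite_table"
    "([1, 4], [2, 3, 4, 5, 7], g3) \<in> set opposite_table"
    "([1, 4, 6], [1, 2, 5, 7], g4) \<in> set opposite_table"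
    "([2, 5, 7], [2, 3, 4, 5], g5) \<in> set opposite_table"
    by (rule opposite_table_entries)
  have J: "[] \<in> set (subseqs all_nodes)" "[1] \<in> set (subseqs all_nodes)"
    "[1, 4] \<in> set (subseqs all_nodes)" "[1, 4, 6] \<in> set (subseqs all_nodes)"
    "[2, 5, 7] \<in> set (subseqs all_nodes)"
    using opposite_table_check t by (auto simp: list_all_iff intro!: table_subseqs)
  \<comment> \<open>Traces of absolute value 7, 5 and 3 already separate, so those parities stay
    unevaluated; the parity is needed only for the traces 1 and -1, each of which occurs
    twice.\<close>
  have "map (\<lambda>K. E7.class_invariant (cl_E7 (set K))) class_representatives =
    [(7, E7.even_form []), (- 7, E7.even_form []), (5, E7.even_form [1]), (- 5, E7.even_form [1]),
     (3, E7.even_form [1, 4]), (- 3, E7.even_form [1, 4]), (1, False), (- 1, False),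
     (1, True), (- 1, True)]"
    unfolding class_representatives_def list.map
    unfolding class_invariant_opposite[OF t(1) short_longest_words(1)]
      class_invariant_opposite[OF t(2) short_longest_words(2)]
      class_invariant_opposite[OF t(3) short_longest_words(3)]
      class_invariant_opposite[OF t(4) short_longest_words(4)]
      class_invariant_opposite[OF t(5) short_longest_words(5)]
      class_invariant_cl[OF J(1) short_longest_words(1)]
      class_invariant_cl[OF J(2) short_longest_words(2)]
      class_invariant_cl[OF J(3) short_longest_words(3)]
      class_invariant_cl[OF J(4) short_longest_words(4)]
      class_invariant_cl[OF J(5) short_longest_words(5)]
    using even_form_257 not_even_form_146 traces by simp
  then have "distinct (map E7.class_invariant (map (\<lambda>K. cl_E7 (set K)) class_representatives))"
    by (simp add: comp_def)
  then show ?thesis unfolding distinct_map[of E7.class_invariant] by blast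
qed

theorem mainTheorem7:
  shows
    "wo_E7 \<in> carrier W_E7 \<and>
     (\<forall>x\<in>carrier W_E7. wo_E7 \<otimes>\<^bsub>W_E7\<^esub> x = x \<otimes>\<^bsub>W_E7\<^esub> wo_E7) \<and>
     (\<forall>v. \<forall>i\<in>E7_nodes. reflection_rep E7_nodes E7_matrix wo_E7 v i = - v i) \<and>
     conj_class W_E7 ` involutions W_E7 =
       {cl_E7 {}, cl_E7 {1,2,3,4,5,6,7}, cl_E7 {1}, cl_E7 {2,3,4,5,6,7}, cl_E7 {1,4},
        cl_E7 {2,3,4,5,7}, cl_E7 {1,4,6}, cl_E7 {1,2,5,7}, cl_E7 {2,5,7}, cl_E7 {2,3,4,5}} \<and>
     distinct
       [cl_E7 {}, cl_E7 {1,2,3,4,5,6,7}, cl_E7 {1}, cl_E7 {2,3,4,5,6,7}, cl_E7 {1,4},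
        cl_E7 {2,3,4,5,7}, cl_E7 {1,4,6}, cl_E7 {1,2,5,7}, cl_E7 {2,5,7}, cl_E7 {2,3,4,5}] \<and>
     cl_E7 {1} = cl_E7 {3} \<and>
     cl_E7 {1,4} = cl_E7 {1,5} \<and>
     cl_E7 {1,4,6} = cl_E7 {1,2,7} \<and>
     cl_E7 {1,2,5,7} = cl_E7 {2,3,5,7} \<and>
     interchanges_classes W_E7 wo_E7 (cl_E7 {}) (cl_E7 {1,2,3,4,5,6,7}) \<and>
     interchanges_classes W_E7 wo_E7 (cl_E7 {1}) (cl_E7 {2,3,4,5,6,7}) \<and>
     interchanges_classes W_E7 wo_E7 (cl_E7 {1,4}) (cl_E7 {2,3,4,5,7}) \<and>
     interchanges_classes W_E7 wo_E7 (cl_E7 {1,4,6}) (cl_E7 {1,2,5,7}) \<and>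
     interchanges_classes W_E7 wo_E7 (cl_E7 {2,5,7}) (cl_E7 {2,3,4,5})"
proof -
  obtain g1 g2 g3 g4 g5 where
    t: "([], [1, 2, 3, 4, 5, 6, 7], g1) \<in> set opposite_table"
    "([1], [2, 3, 4, 5, 6, 7], g2) \<in> set opposite_table"
    "([1, 4], [2, 3, 4, 5, 7], g3) \<in> set opposite_table"
    "([1, 4, 6], [1, 2, 5, 7], g4) \<in> set opposite_table"
    "([2, 5, 7], [2, 3, 4, 5], g5) \<in> set opposite_table"
    by (rule opposite_table_entries)
  obtain h1 h2 h3 h4 where
    c: "([3], [1], h1) \<in> set conj_table" "([1, 5], [1, 4], h2) \<in> set conj_table"
    "([1, 2, 7], [1, 4, 6], h3) \<in> set conj_table" "([2, 3, 5, 7], [1, 2, 5, 7], h4) \<in> set conj_table"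
    by (rule conj_table_entries)
  have carrier: "wo_E7 \<in> carrier W_E7"
    using wo_word_lists by (simp add: wo_E7_eq W_E7_def E7.carrier_W)
  have rep: "reflection_rep E7_nodes E7_matrix wo_E7 v i = - v i" if "i \<in> E7_nodes" for v i
    unfolding wo_E7_eq E7.reflection_rep_cls[OF wo_word_lists]
    by (rule E7.act_eq_minus[OF act_wo_unit that])
  note classes = conj_class_involutions distinct_classes
  note classes' = classes[unfolded class_representatives_def list.map, simplified list.set image_insert image_empty]
  show ?thesis
    using carrier wo_central rep classes' table_conj[OF c(1)] table_conj[OF c(2)]
      table_conj[OF c(3)] table_conj[OF c(4)]
      opposite_interchanges[OF t(1)] opposite_interchanges[OF t(2)] opposite_interchanges[OF t(3)]
      opposite_interchanges[OF t(4)] opposite_interchanges[OF t(5)]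
    unfolding list.set by (intro conjI ballI allI) (simp_all only:)
qed

end
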